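(* Let $K$ be a field, let $\chi_G$ be a graph filtration of a topological space $X$ over a directed acyclic graph $G=(V,E)$, satisfying the commutative diagram condition, and let $(\{H_k(X_v)\}_{v\in V},\{f_e\}_{e\in E})$ be its commutative $G$-module representation (the $k$-dimensional persistence module), with homology taken with coefficients in $K$. Then: (1) (Standard persistence) If $G$ is the graph corresponding to a filtration $X_0\to X_1\to\cdots\to X_n$ and, for $0\le i\le i+p\le n$, $I_{i,p}$ is the subgraph consisting of the vertices $\{X_i,\dots,X_{i+p}\}$, then $$H_k^{I_{i,p}}(\chi_G)=\alpha_{H_k(X_i)}^{H_k(X_i)}\big(H_k(X_{i+p})\big).$$ (2) (Multidimensional persistence) Let $\chi=\{X_v\}_{v\in\{0,\dots,m\}^d}$ be a multifiltration with underlying graph $G$. If $u\le v$ and $G_{u,v}$ is the subgraph with vertices $\{w\in G\mid u\le w\le v\}$, then the rank invariant satisfies $$\rho_{X,k}(u,v)=\dim\ \alpha_{H_k(X_u)}^{H_k(X_u)}\big(H_k(X_v)\big).$$ In both parts, the morphisms considered in the preradical $\alpha$ are only those appearing in the commutative $G$-module representation, i.e. the composites of the maps $f_e$ along directed paths.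
   Context: Graph filtration: for a simple directed acyclic graph $G=(V,E)$, a graph filtration $\chi_G$ of a topological space $X$ is a pair $(\{X_v\}_{v\in V},\{f_e\}_{e\in E})$ with $X_v\subset X$ for all $v\in V$ and, for each edge $e=(u,v)$, a continuous embedding (or inclusion) $f_e:X_u\to X_v$. The commutative diagram condition: for any two directed paths in $G$ with the same starting vertex and the same ending vertex, the composites of the maps along the two paths are equal. The $k$-dimensional persistence module of $\chi_G$ is the commutative $G$-module with vector spaces $W_v=H_k(X_v)$ (the $k$-th homology group with coefficients in the field $K$) and, for each edge $e=(u,v)$, the $K$-linear map $f_e:H_k(X_u)\to H_k(X_v)$ induced by $X_u\hookrightarrow X_v$. For a directed path $\gamma=e_1,\dots,e_r$ put $f_\gamma=f_{e_r}\circ\cdots\circ f_{e_1}$ (identity for a trivial path). A commutative $G$-module in general consists of a $K$-vector space $W_v$ for each vertex and a $K$-linear map $f_e:W_u\to W_v$ for each edge $e=(u,v)$, such that $f_\gamma=f_{\gamma'}$ for any directed paths $\gamma,\gamma'$ with the same endpoints. Persistence: for a commutative $G$-module $M$ with limit cone $(\lim(M),\{\eta_v\})$ and colimit cocone $(\operatorname{colim}(M),\{\iota_v\})$ in $K$-Mod, $P(M)$ is the image of the induced morphism $\varphi_M:\lim(M)\to\operatorname{colim}(M)$, $\varphi_M=\iota_v\circ\eta_v$. For a subgraph $I$ of $G$, $H_k^I(\chi_G)$ denotes the persistence of the restriction to $I$ of the $k$-dimensional persistence module. For $I=I_{i,p}$, the limit of the restricted module is identified with $H_k(X_i)$ and its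 colimit with $H_k(X_{i+p})$ via the canonical maps, so that $H_k^{I_{i,p}}(\chi_G)$ is the image of $H_k(X_i)\to H_k(X_{i+p})$. Multifiltration: a family $\{X_v\}_{v\in\{0,\dots,m\}^d}$ of subspaces of $X$ with $X_u\subseteq X_v$ whenever $u\le v$ coordinatewise; the underlying graph $G$ has vertex set $\{0,\dots,m\}^d$ and edges increasing one coordinate by $1$ (inclusion maps parallel to the coordinate axes). The rank invariant $\rho_{X,k}(u,v)$, for $u\le v$, is the dimension of the image of the map $H_k(X_u)\to H_k(X_v)$ induced by inclusion. Preradical $\alpha$: for a $K$-module $A$ and a submodule $N\subseteq A$, $\alpha_N^A(W)=\sum\{f(N)\mid f\in\operatorname{Hom}(A,W)\}$, where in this statement the morphisms are restricted to those arising in the commutative $G$-module representation; thus for vertices $a,b$, $\alpha_{H_k(X_a)}^{H_k(X_a)}(H_k(X_b))=\sum\{f_\gamma(H_k(X_a))\mid \gamma \text{ a directed path from } a \text{ to } b\}$. *)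

theory Defs
  imports
    "HOL-Homology.Homology"
    "Graph_Theory.Digraph_Component"
    "Jordan_Normal_Form.VS_Connect"
    "HOL-Library.Extended_Nat"
begin

hide_const (open) Multiset.mult

section \<open>Vector spaces\<close>

text \<open>A field \<open>K\<close> is given by a type \<open>'k\<close> of class \<open>field\<close>; a vector space over it is a module record
  \<open>V\<close> with \<open>vectorspace class_ring V\<close>. As usual for such records, the ring-multiplication slots
  \<open>mult\<close> and \<open>one\<close> carry no meaning.\<close>

definition vs_iso :: "('k::field, 'v) module \<Rightarrow> ('k, 'w) module \<Rightarrow> ('v \<Rightarrow> 'w) \<Rightarrow> bool" where
  "vs_iso V W T \<longleftrightarrow> linear_map class_ring V W T \<and> bij_betw T (carrier V) (carrier W)"

text \<open>The library's \<open>vectorspace.dim\<close> is a natural number that is unspecified in infinite dimension,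
  hence the case distinction.\<close>

definition vs_dim :: "('k::field, 'v) module \<Rightarrow> 'v set \<Rightarrow> enat" where
  "vs_dim V U =
     (if vectorspace.fin_dim class_ring (V\<lparr>carrier := U\<rparr>)
      then enat (vectorspace.dim class_ring (V\<lparr>carrier := U\<rparr>)) else \<infinity>)"

definition quotient_space :: "('k::field, 'v) module \<Rightarrow> 'v set \<Rightarrow> ('k, 'v set) module" where
  "quotient_space V U =
     \<lparr>carrier = a_rcosets\<^bsub>V\<^esub> U, mult = undefined, one = undefined, zero = U,
      add = set_add V, smult = (\<lambda>a A. \<Union>x\<in>A. U +>\<^bsub>V\<^esub> (a \<odot>\<^bsub>V\<^esub> x))\<rparr>"

text \<open>The sum of an arbitrary (possibly infinite) family of subspaces: all finite sums of elements
  of members of the family.\<close>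

definition sum_of_subspaces :: "('k::field, 'v) module \<Rightarrow> 'v set set \<Rightarrow> 'v set" where
  "sum_of_subspaces V \<N> = {finsum V x I | x I. finite I \<and> I \<subseteq> \<N> \<and> (\<forall>N\<in>I. x N \<in> N)}"


section \<open>Singular homology with coefficients in a field\<close>

text \<open>The library's singular homology has integer coefficients. The following repeats its
  construction (\<open>frag_extend\<close>, \<open>chain_boundary\<close>, \<open>chain_map\<close>) on top of the same singular simplices,
  with chains being finitely supported functions into \<open>'k\<close>.\<close>

type_synonym ('a, 'k) kchain = "((nat \<Rightarrow> real) \<Rightarrow> 'a) \<Rightarrow>\<^sub>0 'k"

definition scale_chain :: "'k::field \<Rightarrow> ('s \<Rightarrow>\<^sub>0 'k) \<Rightarrow> ('s \<Rightarrow>\<^sub>0 'k)" where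
  "scale_chain a = Poly_Mapping.map ((*) a)"

definition kchain_extend :: "('s \<Rightarrow> ('t \<Rightarrow>\<^sub>0 'k)) \<Rightarrow> ('s \<Rightarrow>\<^sub>0 'k::field) \<Rightarrow> ('t \<Rightarrow>\<^sub>0 'k)" where
  "kchain_extend b c =
     (\<Sum>s \<in> Poly_Mapping.keys c. scale_chain (Poly_Mapping.lookup c s) (b s))"

definition kchain_boundary :: "nat \<Rightarrow> ('a, 'k::field) kchain \<Rightarrow> ('a, 'k) kchain" where
  "kchain_boundary p c =
     (if p = 0 then 0
      else kchain_extend (\<lambda>s. \<Sum>i\<le>p. Poly_Mapping.single (singular_face p i s) ((-1) ^ i)) c)"

definition kchain_map :: "nat \<Rightarrow> ('a \<Rightarrow> 'b) \<Rightarrow> ('a, 'k::field) kchain \<Rightarrow> ('b, 'k) kchain" where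
  "kchain_map p f = kchain_extend (\<lambda>s. Poly_Mapping.single (simplex_map p f s) 1)"

definition chain_space :: "nat \<Rightarrow> 'a topology \<Rightarrow> ('k::field, ('a, 'k) kchain) module" where
  "chain_space p S =
     \<lparr>carrier = {c. Poly_Mapping.keys c \<subseteq> singular_simplex_set p S},
      mult = undefined, one = undefined, zero = 0, add = (+), smult = scale_chain\<rparr>"

definition cycles :: "nat \<Rightarrow> 'a topology \<Rightarrow> ('a, 'k::field) kchain set" where
  "cycles p S = {c \<in> carrier (chain_space p S). kchain_boundary p c = 0}"

definition boundaries :: "nat \<Rightarrow> 'a topology \<Rightarrow> ('a, 'k::field) kchain set" where
  "boundaries p S = kchain_boundary (Suc p) ` carrier (chain_space (Suc p) S)"

text \<open>\<open>homology_space K p S\<close> is \<open>H\<^sub>p(S; K)\<close>; the argument \<open>K\<close> only fixes the coefficient field.\<close>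

definition homology_space ::
    "'k::field itself \<Rightarrow> nat \<Rightarrow> 'a topology \<Rightarrow> ('k, ('a, 'k) kchain set) module" where
  "homology_space K p S = quotient_space ((chain_space p S)\<lparr>carrier := cycles p S\<rparr>) (boundaries p S)"

text \<open>\<open>homology_map K p T f\<close> is the map \<open>H\<^sub>p(S; K) \<rightarrow> H\<^sub>p(T; K)\<close> induced by \<open>f : S \<rightarrow> T\<close>; it does not
  need \<open>S\<close>, since a homology class is the set of its representatives.\<close>

definition homology_map ::
    "'k::field itself \<Rightarrow> nat \<Rightarrow> 'b topology \<Rightarrow> ('a \<Rightarrow> 'b) \<Rightarrow>
     ('a, 'k) kchain set \<Rightarrow> ('b, 'k) kchain set" where
  "homology_map K p T f A = (\<Union>z\<in>A. boundaries p T +>\<^bsub>chain_space p T\<^esub> kchain_map p f z)"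


section \<open>Graph filtrations\<close>

definition simple_dag :: "('v, 'e) pre_digraph \<Rightarrow> bool" where
  "simple_dag G \<longleftrightarrow> loopfree_digraph G \<and> nomulti_digraph G \<and> \<not> (\<exists>p. pre_digraph.cycle G p)"

text \<open>The composite \<open>F e\<^sub>r \<circ> \<dots> \<circ> F e\<^sub>1\<close> along a directed path, given as the list \<open>e\<^sub>1, \<dots>, e\<^sub>r\<close> of its arcs.\<close>

definition path_map :: "('e \<Rightarrow> 'w \<Rightarrow> 'w) \<Rightarrow> 'e list \<Rightarrow> 'w \<Rightarrow> 'w" where
  "path_map F p = fold F p"

definition graph_filtration ::
    "'a topology \<Rightarrow> ('v, 'e) pre_digraph \<Rightarrow> ('v \<Rightarrow> 'a set) \<Rightarrow> ('e \<Rightarrow> 'a \<Rightarrow> 'a) \<Rightarrow> bool" where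
  "graph_filtration X G Xs f \<longleftrightarrow>
     simple_dag G \<and> (\<forall>v\<in>verts G. Xs v \<subseteq> topspace X) \<and>
     (\<forall>e\<in>arcs G. embedding_map (subtopology X (Xs (tail G e))) (subtopology X (Xs (head G e))) (f e))"

definition commutative_diagram ::
    "('v, 'e) pre_digraph \<Rightarrow> ('v \<Rightarrow> 'a set) \<Rightarrow> ('e \<Rightarrow> 'a \<Rightarrow> 'a) \<Rightarrow> bool" where
  "commutative_diagram G Xs f \<longleftrightarrow>
     (\<forall>u v p q. pre_digraph.awalk G u p v \<longrightarrow> pre_digraph.awalk G u q v \<longrightarrow>
        (\<forall>x\<in>Xs u. path_map f p x = path_map f q x))"

text \<open>The \<open>k\<close>-dimensional persistence module: its spaces and its linear maps.\<close>

definition pers_space ::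
    "'k::field itself \<Rightarrow> nat \<Rightarrow> 'a topology \<Rightarrow> ('v \<Rightarrow> 'a set) \<Rightarrow> 'v \<Rightarrow> ('k, ('a, 'k) kchain set) module" where
  "pers_space K k X Xs v = homology_space K k (subtopology X (Xs v))"

definition pers_map ::
    "'k::field itself \<Rightarrow> nat \<Rightarrow> 'a topology \<Rightarrow> ('v, 'e) pre_digraph \<Rightarrow> ('v \<Rightarrow> 'a set) \<Rightarrow>
     ('e \<Rightarrow> 'a \<Rightarrow> 'a) \<Rightarrow> 'e \<Rightarrow> ('a, 'k) kchain set \<Rightarrow> ('a, 'k) kchain set" where
  "pers_map K k X G Xs f e = homology_map K k (subtopology X (Xs (head G e))) (f e)"


section \<open>Limit, colimit and persistence of a commutative module over a graph\<close>

text \<open>Below, \<open>W v\<close> are the vector spaces and \<open>F e\<close> the linear maps of the module. The restriction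
  of the module to a subgraph \<open>I\<close> is obtained by using \<open>I\<close> in place of \<open>G\<close>. The limit is the space of
  compatible families; the colimit is the quotient of the direct sum by the relations
  \<open>w = F e w\<close>.\<close>

definition product_space ::
    "('v, 'e) pre_digraph \<Rightarrow> ('v \<Rightarrow> ('k::field, 'w) module) \<Rightarrow> ('k, 'v \<Rightarrow> 'w) module" where
  "product_space G W =
     \<lparr>carrier = (\<Pi>\<^sub>E v\<in>verts G. carrier (W v)), mult = undefined, one = undefined,
      zero = (\<lambda>v\<in>verts G. \<zero>\<^bsub>W v\<^esub>),
      add = (\<lambda>x y. \<lambda>v\<in>verts G. x v \<oplus>\<^bsub>W v\<^esub> y v),
      smult = (\<lambda>a x. \<lambda>v\<in>verts G. a \<odot>\<^bsub>W v\<^esub> x v)\<rparr>"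

definition lim_space ::
    "('v, 'e) pre_digraph \<Rightarrow> ('v \<Rightarrow> ('k::field, 'w) module) \<Rightarrow> ('e \<Rightarrow> 'w \<Rightarrow> 'w) \<Rightarrow>
     ('k, 'v \<Rightarrow> 'w) module" where
  "lim_space G W F = (product_space G W)
     \<lparr>carrier := {x \<in> carrier (product_space G W). \<forall>e\<in>arcs G. F e (x (tail G e)) = x (head G e)}\<rparr>"

definition lim_proj :: "'v \<Rightarrow> ('v \<Rightarrow> 'w) \<Rightarrow> 'w" where
  "lim_proj v x = x v"

definition direct_sum_space ::
    "('v, 'e) pre_digraph \<Rightarrow> ('v \<Rightarrow> ('k::field, 'w) module) \<Rightarrow> ('k, 'v \<Rightarrow> 'w) module" where
  "direct_sum_space G W = (product_space G W)
     \<lparr>carrier := {x \<in> carrier (product_space G W). finite {v\<in>verts G. x v \<noteq> \<zero>\<^bsub>W v\<^esub>}}\<rparr>"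

definition direct_sum_inj ::
    "('v, 'e) pre_digraph \<Rightarrow> ('v \<Rightarrow> ('k::field, 'w) module) \<Rightarrow> 'v \<Rightarrow> 'w \<Rightarrow> 'v \<Rightarrow> 'w" where
  "direct_sum_inj G W v w = (\<lambda>u\<in>verts G. if u = v then w else \<zero>\<^bsub>W u\<^esub>)"

definition colim_relations ::
    "('v, 'e) pre_digraph \<Rightarrow> ('v \<Rightarrow> ('k::field, 'w) module) \<Rightarrow> ('e \<Rightarrow> 'w \<Rightarrow> 'w) \<Rightarrow> ('v \<Rightarrow> 'w) set" where
  "colim_relations G W F = LinearCombinations.module.span class_ring (direct_sum_space G W)
     {direct_sum_inj G W (tail G e) w \<ominus>\<^bsub>direct_sum_space G W\<^esub> direct_sum_inj G W (head G e) (F e w)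
        | e w. e \<in> arcs G \<and> w \<in> carrier (W (tail G e))}"

definition colim_space ::
    "('v, 'e) pre_digraph \<Rightarrow> ('v \<Rightarrow> ('k::field, 'w) module) \<Rightarrow> ('e \<Rightarrow> 'w \<Rightarrow> 'w) \<Rightarrow>
     ('k, ('v \<Rightarrow> 'w) set) module" where
  "colim_space G W F = quotient_space (direct_sum_space G W) (colim_relations G W F)"

definition colim_inj ::
    "('v, 'e) pre_digraph \<Rightarrow> ('v \<Rightarrow> ('k::field, 'w) module) \<Rightarrow> ('e \<Rightarrow> 'w \<Rightarrow> 'w) \<Rightarrow>
     'v \<Rightarrow> 'w \<Rightarrow> ('v \<Rightarrow> 'w) set" where
  "colim_inj G W F v w = colim_relations G W F +>\<^bsub>direct_sum_space G W\<^esub> direct_sum_inj G W v w"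

text \<open>The morphism from the limit to the colimit is \<open>\<iota>\<^sub>v \<circ> \<eta>\<^sub>v\<close> for every vertex \<open>v\<close>; it is
  well defined when the graph is connected and nonempty.\<close>

definition lim_to_colim ::
    "('v, 'e) pre_digraph \<Rightarrow> ('v \<Rightarrow> ('k::field, 'w) module) \<Rightarrow> ('e \<Rightarrow> 'w \<Rightarrow> 'w) \<Rightarrow>
     ('v \<Rightarrow> 'w) \<Rightarrow> ('v \<Rightarrow> 'w) set" where
  "lim_to_colim G W F x = (THE y. \<forall>v\<in>verts G. y = colim_inj G W F v (lim_proj v x))"

definition persistence ::
    "('v, 'e) pre_digraph \<Rightarrow> ('v \<Rightarrow> ('k::field, 'w) module) \<Rightarrow> ('e \<Rightarrow> 'w \<Rightarrow> 'w) \<Rightarrow>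
     ('v \<Rightarrow> 'w) set set" where
  "persistence G W F = lim_to_colim G W F ` carrier (lim_space G W F)"


section \<open>The preradical\<close>

text \<open>\<open>preradical H N W\<close> is the sum of all \<open>f(N)\<close> with \<open>f \<in> H\<close>, where \<open>H\<close> stands for
  the admitted morphisms from the ambient space of \<open>N\<close> to \<open>W\<close>.\<close>

definition preradical :: "('u \<Rightarrow> 'w) set \<Rightarrow> 'u set \<Rightarrow> ('k::field, 'w) module \<Rightarrow> 'w set" where
  "preradical H N W = sum_of_subspaces W {f ` N | f. f \<in> H}"

definition path_homs ::
    "('v, 'e) pre_digraph \<Rightarrow> ('e \<Rightarrow> 'w \<Rightarrow> 'w) \<Rightarrow> 'v \<Rightarrow> 'v \<Rightarrow> ('w \<Rightarrow> 'w) set" where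
  "path_homs G F a b = {path_map F p | p. pre_digraph.awalk G a p b}"

text \<open>For \<open>A = N = W a\<close>, with the morphisms of the commutative module only.\<close>

definition preradical_between ::
    "('v, 'e) pre_digraph \<Rightarrow> ('v \<Rightarrow> ('k::field, 'w) module) \<Rightarrow> ('e \<Rightarrow> 'w \<Rightarrow> 'w) \<Rightarrow>
     'v \<Rightarrow> 'v \<Rightarrow> 'w set" where
  "preradical_between G W F a b = preradical (path_homs G F a b) (carrier (W a)) (W b)"


section \<open>Filtrations and multifiltrations\<close>

definition filtration_graph :: "nat \<Rightarrow> (nat, nat \<times> nat) pre_digraph" where
  "filtration_graph n = \<lparr>verts = {0..n}, arcs = {(j, Suc j) | j. j < n}, tail = fst, head = snd\<rparr>"

text \<open>Points of \<open>{0,\<dots>,m}\<^sup>d\<close> are extensional functions on \<open>{..<d}\<close>.\<close>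

definition grid :: "nat \<Rightarrow> nat \<Rightarrow> (nat \<Rightarrow> nat) set" where
  "grid d m = {..<d} \<rightarrow>\<^sub>E {0..m}"

definition coord_le :: "nat \<Rightarrow> (nat \<Rightarrow> nat) \<Rightarrow> (nat \<Rightarrow> nat) \<Rightarrow> bool" where
  "coord_le d u v \<longleftrightarrow> (\<forall>i<d. u i \<le> v i)"

definition grid_graph :: "nat \<Rightarrow> nat \<Rightarrow> (nat \<Rightarrow> nat, (nat \<Rightarrow> nat) \<times> (nat \<Rightarrow> nat)) pre_digraph" where
  "grid_graph d m =
     \<lparr>verts = grid d m,
      arcs = {(w, w(i := Suc (w i))) | w i. w \<in> grid d m \<and> i < d \<and> w i < m},
      tail = fst, head = snd\<rparr>"

definition multifiltration ::
    "'a topology \<Rightarrow> nat \<Rightarrow> nat \<Rightarrow> ((nat \<Rightarrow> nat) \<Rightarrow> 'a set) \<Rightarrow> bool" where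
  "multifiltration X d m Xs \<longleftrightarrow>
     (\<forall>v\<in>grid d m. Xs v \<subseteq> topspace X) \<and>
     (\<forall>u\<in>grid d m. \<forall>v\<in>grid d m. coord_le d u v \<longrightarrow> Xs u \<subseteq> Xs v)"

subsection \<open>These are instances of graph filtrations\<close>

lemma no_cycle_if_measure:
  fixes \<mu> :: "'v \<Rightarrow> nat"
  assumes "\<And>e. e \<in> arcs G \<Longrightarrow> \<mu> (tail G e) < \<mu> (head G e)"
  shows "\<not> (\<exists>p. pre_digraph.cycle G p)"
proof -
  have "\<mu> u < \<mu> v" if "pre_digraph.cas G u p v" "set p \<subseteq> arcs G" "p \<noteq> []" for u p v
    using that
  proof (induction p arbitrary: u)
    case Nil
    then show ?case by simp
  next
    case (Cons e p)
    have "\<mu> u < \<mu> (head G e)"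
      using Cons.prems assms[of e] by (auto simp: pre_digraph.cas.simps)
    moreover have "\<mu> (head G e) \<le> \<mu> v"
      using Cons.IH[of "head G e"] Cons.prems by (cases p) (auto simp: pre_digraph.cas.simps)
    ultimately show ?case by simp
  qed
  then show ?thesis
    unfolding pre_digraph.cycle_def pre_digraph.awalk_def by blast
qed

lemma simple_dag_filtration_graph: "simple_dag (filtration_graph n)"
proof -
  have "\<not> (\<exists>p. pre_digraph.cycle (filtration_graph n) p)"
    by (rule no_cycle_if_measure[where \<mu> = id]) (auto simp: filtration_graph_def)
  then show ?thesis
    unfolding simple_dag_def
    by (auto simp: filtration_graph_def loopfree_digraph_def nomulti_digraph_def wf_digraph_def
        loopfree_digraph_axioms_def nomulti_digraph_axioms_def arc_to_ends_def)
qed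

lemma simple_dag_grid_graph: "simple_dag (grid_graph d m)"
proof -
  have "\<not> (\<exists>p. pre_digraph.cycle (grid_graph d m) p)"
  proof (rule no_cycle_if_measure[where \<mu> = "\<lambda>w. \<Sum>i<d. w i"])
    fix e assume "e \<in> arcs (grid_graph d m)"
    then obtain w i where e: "e = (w, w(i := Suc (w i)))" "i < d"
      by (auto simp: grid_graph_def)
    have "(\<Sum>j<d. w j) < (\<Sum>j<d. (w(i := Suc (w i))) j)"
      by (rule sum_strict_mono_ex1) (use e in auto)
    then show "(\<Sum>i<d. tail (grid_graph d m) e i) < (\<Sum>i<d. head (grid_graph d m) e i)"
      using e by (simp add: grid_graph_def)
  qed
  moreover have "w(i := Suc (w i)) \<in> grid d m" if "w \<in> grid d m" "i < d" "w i < m" for w i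
    using that by (auto simp: grid_def PiE_iff extensional_def)
  moreover have "w \<noteq> w(i := Suc (w i))" for w :: "nat \<Rightarrow> nat" and i
    by (metis fun_upd_same n_not_Suc_n)
  ultimately show ?thesis
    unfolding simple_dag_def
    by (auto simp: grid_graph_def loopfree_digraph_def nomulti_digraph_def wf_digraph_def
        loopfree_digraph_axioms_def nomulti_digraph_axioms_def arc_to_ends_def)
qed

lemma multifiltration_graph_filtration:
  assumes "multifiltration X d m Xs"
  shows "graph_filtration X (grid_graph d m) Xs (\<lambda>_. id)"
    and "commutative_diagram (grid_graph d m) Xs (\<lambda>_. id)"
proof -
  have "embedding_map (subtopology X (Xs (tail (grid_graph d m) e)))
          (subtopology X (Xs (head (grid_graph d m) e))) id"
    if arc: "e \<in> arcs (grid_graph d m)" for e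
  proof -
    obtain w i where e: "e = (w, w(i := Suc (w i)))" "i < d" "w i < m" "w \<in> grid d m"
      using arc by (auto simp: grid_graph_def)
    have "w(i := Suc (w i)) \<in> grid d m"
      using e by (auto simp: grid_def PiE_iff extensional_def)
    moreover have "coord_le d w (w(i := Suc (w i)))"
      by (auto simp: coord_le_def)
    ultimately have "Xs w \<subseteq> Xs (w(i := Suc (w i)))"
      using assms e by (auto simp: multifiltration_def)
    then have "subtopology (subtopology X (Xs (w(i := Suc (w i))))) (topspace X \<inter> Xs w)
               = subtopology X (Xs w)"
      by (simp add: subtopology_subtopology inf_absorb2 inf.assoc[symmetric] inf_commute
          subtopology_restrict)
        (metis inf.absorb_iff2 inf_commute inf_left_commute subtopology_restrict)
    then show ?thesis
      using e by (simp add: grid_graph_def embedding_map_def)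
  qed
  then show "graph_filtration X (grid_graph d m) Xs (\<lambda>_. id)"
    using assms simple_dag_grid_graph
    by (auto simp: graph_filtration_def multifiltration_def grid_graph_def)
  have "fold (\<lambda>_. id) p x = x" for p :: "((nat \<Rightarrow> nat) \<times> (nat \<Rightarrow> nat)) list" and x :: 'a
    by (induction p) auto
  then show "commutative_diagram (grid_graph d m) Xs (\<lambda>_. id)"
    by (simp add: commutative_diagram_def path_map_def)
qed

text \<open>All maps of a multifiltration are inclusions, so they are represented by the identity function.\<close>

definition rank_invariant ::
    "'k::field itself \<Rightarrow> nat \<Rightarrow> 'a topology \<Rightarrow> ('v \<Rightarrow> 'a set) \<Rightarrow> 'v \<Rightarrow> 'v \<Rightarrow> enat" where
  "rank_invariant K k X Xs u v =
     vs_dim (homology_space K k (subtopology X (Xs v)))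
       (homology_map K k (subtopology X (Xs v)) id ` carrier (homology_space K k (subtopology X (Xs u))))"

end

theory Submission
  imports Defs
begin

text \<open>In both parts all paths between the two given vertices induce the same map on homology: in a
  filtration graph there is only one path, and in a multifiltration every path composes inclusions.
  Hence the sum defining the preradical has a single term, the image of that map.

  For a linear graph from \<open>i\<close> to \<open>j\<close>, a compatible family is determined by its component at \<open>i\<close>, and
  every class in the colimit has a unique representative at \<open>j\<close>. Under these identifications the
  morphism from the limit to the colimit is the composite \<open>W i \<rightarrow> W j\<close>.\<close>

section \<open>Linear maps and quotient spaces\<close>

text \<open>Persistence consists of elements of the colimit, while the preradical lies in
  \<open>W (i + p)\<close>. The equality is therefore stated through \<open>colim_inj\<close>, and
  its being an isomorphism is part of the claim. The delicate half of that is injectivity: the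
  relations form a span, so two vectors at the last vertex could be identified by a long combination
  of generators. This is excluded by a linear map out of the direct sum that vanishes on every
  generator and restores a vector placed at the last vertex. In the grid, walks between two vertices
  differ as lists, so functoriality of homology enters, for inclusions. It is obtained on chains:
  \<open>kchain_map p id\<close> fixes every chain with the right support, so an inclusion
  transports a class by keeping its representing cycle. The preradical sums over a set of images, so
  walks with equal images contribute once; a walk has to exist, since the sum of the empty family is
  zero.\<close>

lemma linear_mapI:
  fixes V :: "('k::field, 'v) module" and W :: "('k, 'w) module"
  assumes "vectorspace class_ring V" "vectorspace class_ring W"
    and "\<And>x. x \<in> carrier V \<Longrightarrow> T x \<in> carrier W"
    and "\<And>x y. x \<in> carrier V \<Longrightarrow> y \<in> carrier V \<Longrightarrow> T (x \<oplus>\<^bsub>V\<^esub> y) = T x \<oplus>\<^bsub>W\<^esub> T y"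
    and "\<And>a x. x \<in> carrier V \<Longrightarrow> T (a \<odot>\<^bsub>V\<^esub> x) = a \<odot>\<^bsub>W\<^esub> T x"
  shows "linear_map class_ring V W T"
  using assms unfolding linear_map_def mod_hom_def mod_hom_axioms_def module_hom_def
  by (auto simp: vectorspace_def)

lemma linear_map_vectorspaces:
  assumes "linear_map K V W T"
  shows "vectorspace K V" "vectorspace K W"
  using assms by (auto simp: linear_map_def)

lemma linear_map_closed:
  assumes "linear_map K V W T" "x \<in> carrier V"
  shows "T x \<in> carrier W"
proof -
  interpret linear_map K V W T by fact
  show ?thesis using assms(2) by simp
qed

lemma
  assumes "linear_map (class_ring :: 'k::field ring) V W T"
  shows linear_map_add: "\<And>x y. x \<in> carrier V \<Longrightarrow> y \<in> carrier V \<Longrightarrow> T (x \<oplus>\<^bsub>V\<^esub> y) = T x \<oplus>\<^bsub>W\<^esub> T y"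
    and linear_map_smult: "\<And>a x. x \<in> carrier V \<Longrightarrow> T (a \<odot>\<^bsub>V\<^esub> x) = a \<odot>\<^bsub>W\<^esub> T x"
    and linear_map_zero: "T \<zero>\<^bsub>V\<^esub> = \<zero>\<^bsub>W\<^esub>"
proof -
  interpret linear_map class_ring V W T by fact
  show "\<And>x y. x \<in> carrier V \<Longrightarrow> y \<in> carrier V \<Longrightarrow> T (x \<oplus>\<^bsub>V\<^esub> y) = T x \<oplus>\<^bsub>W\<^esub> T y"
    and "\<And>a x. x \<in> carrier V \<Longrightarrow> T (a \<odot>\<^bsub>V\<^esub> x) = a \<odot>\<^bsub>W\<^esub> T x"
    and "T \<zero>\<^bsub>V\<^esub> = \<zero>\<^bsub>W\<^esub>"
    by auto
qed

lemma linear_map_comp: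
  fixes U :: "('k::field, 'u) module" and V :: "('k, 'v) module" and W :: "('k, 'w) module"
  assumes S: "linear_map class_ring U V S" and T: "linear_map class_ring V W T"
  shows "linear_map class_ring U W (T \<circ> S)"
proof -
  interpret S: linear_map class_ring U V S by fact
  interpret T: linear_map class_ring V W T by fact
  show ?thesis
    by (rule linear_mapI) (use S.V.vectorspace_axioms T.W.vectorspace_axioms in auto)
qed

lemma linear_map_id:
  fixes V :: "('k::field, 'v) module"
  assumes "vectorspace class_ring V"
  shows "linear_map class_ring V V id"
  by (rule linear_mapI) (use assms in auto)

lemma subspaceI:
  fixes V :: "('k::field, 'v) module"
  assumes "vectorspace class_ring V" "U \<subseteq> carrier V" "\<zero>\<^bsub>V\<^esub> \<in> U"
    and "\<And>x y. x \<in> U \<Longrightarrow> y \<in> U \<Longrightarrow> x \<oplus>\<^bsub>V\<^esub> y \<in> U"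
    and "\<And>a x. x \<in> U \<Longrightarrow> a \<odot>\<^bsub>V\<^esub> x \<in> U"
  shows "VectorSpace.subspace class_ring U V"
  using assms by (auto simp: VectorSpace.subspace_def LinearCombinations.submodule_def vectorspace_def)

text \<open>Every axiom for \<open>Q\<close> is an equation or an existence claim that can be
  checked on preimages in \<open>V\<close>. This spares computing with the set operations of a
  quotient record.\<close>

lemma vectorspace_of_surjection:
  fixes V :: "('k::field, 'v) module" and Q :: "('k, 'q) module"
  assumes V: "vectorspace class_ring V" and surj: "carrier Q = T ` carrier V"
    and zero: "\<zero>\<^bsub>Q\<^esub> = T \<zero>\<^bsub>V\<^esub>"
    and add: "\<And>x y. x \<in> carrier V \<Longrightarrow> y \<in> carrier V \<Longrightarrow> T x \<oplus>\<^bsub>Q\<^esub> T y = T (x \<oplus>\<^bsub>V\<^esub> y)"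
    and smult: "\<And>a x. x \<in> carrier V \<Longrightarrow> a \<odot>\<^bsub>Q\<^esub> T x = T (a \<odot>\<^bsub>V\<^esub> x)"
  shows "vectorspace class_ring Q" "linear_map class_ring V Q T"
proof -
  interpret vectorspace class_ring V by fact
  have neg: "\<exists>y\<in>carrier Q. T x \<oplus>\<^bsub>Q\<^esub> y = \<zero>\<^bsub>Q\<^esub>" if "x \<in> carrier V" for x
    using that by (intro bexI[of _ "T (\<ominus>\<^bsub>V\<^esub> x)"]) (auto simp: surj zero add M.r_neg)
  show Q: "vectorspace class_ring Q"
  proof (rule vs_criteria)
    show "field (class_ring :: 'k ring)" by (rule class_field)
    show "\<zero>\<^bsub>Q\<^esub> \<in> carrier Q" by (auto simp: surj zero)
    show "\<forall>v w. v \<in> carrier Q \<and> w \<in> carrier Q \<longrightarrow> v \<oplus>\<^bsub>Q\<^esub> w \<in> carrier Q"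
      by (auto simp: surj add)
    show "\<forall>v\<in>carrier Q. \<exists>w\<in>carrier Q. v \<oplus>\<^bsub>Q\<^esub> w = \<zero>\<^bsub>Q\<^esub>"
      unfolding surj by (intro ballI, erule imageE) (metis neg surj)
    show "\<forall>c v. c \<in> carrier class_ring \<and> v \<in> carrier Q \<longrightarrow> c \<odot>\<^bsub>Q\<^esub> v \<in> carrier Q"
      by (auto simp: surj smult)
    show "\<forall>v w. v \<in> carrier Q \<and> w \<in> carrier Q \<longrightarrow> v \<oplus>\<^bsub>Q\<^esub> w = w \<oplus>\<^bsub>Q\<^esub> v"
      by (auto simp: surj add M.a_comm)
    show "\<forall>v w x. v \<in> carrier Q \<and> w \<in> carrier Q \<and> x \<in> carrier Q \<longrightarrow>
        v \<oplus>\<^bsub>Q\<^esub> w \<oplus>\<^bsub>Q\<^esub> x = v \<oplus>\<^bsub>Q\<^esub> (w \<oplus>\<^bsub>Q\<^esub> x)"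
      by (auto simp: surj add M.a_assoc)
    show "\<forall>v\<in>carrier Q. v \<oplus>\<^bsub>Q\<^esub> \<zero>\<^bsub>Q\<^esub> = v"
      by (auto simp: surj zero add)
    show "\<forall>a b v. a \<in> carrier class_ring \<and> b \<in> carrier class_ring \<and> v \<in> carrier Q \<longrightarrow>
        (a \<otimes>\<^bsub>class_ring\<^esub> b) \<odot>\<^bsub>Q\<^esub> v = a \<odot>\<^bsub>Q\<^esub> (b \<odot>\<^bsub>Q\<^esub> v)"
      using smult_assoc1 by (auto simp: surj smult)
    show "\<forall>v\<in>carrier Q. \<one>\<^bsub>class_ring\<^esub> \<odot>\<^bsub>Q\<^esub> v = v"
      using smult_one by (auto simp: surj smult)
    show "\<forall>a b v. a \<in> carrier class_ring \<and> b \<in> carrier class_ring \<and> v \<in> carrier Q \<longrightarrow>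
        (a \<oplus>\<^bsub>class_ring\<^esub> b) \<odot>\<^bsub>Q\<^esub> v = a \<odot>\<^bsub>Q\<^esub> v \<oplus>\<^bsub>Q\<^esub> b \<odot>\<^bsub>Q\<^esub> v"
      using smult_l_distr by (auto simp: surj smult add)
    show "\<forall>a v w. a \<in> carrier class_ring \<and> v \<in> carrier Q \<and> w \<in> carrier Q \<longrightarrow>
        a \<odot>\<^bsub>Q\<^esub> (v \<oplus>\<^bsub>Q\<^esub> w) = a \<odot>\<^bsub>Q\<^esub> v \<oplus>\<^bsub>Q\<^esub> a \<odot>\<^bsub>Q\<^esub> w"
      using smult_r_distr by (auto simp: surj smult add)
  qed
  show "linear_map class_ring V Q T"
    by (rule linear_mapI) (use V Q in \<open>auto simp: surj add smult\<close>)
qed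

section \<open>Quotients by a subspace and the maps induced on them\<close>

locale space_with_subspace = vectorspace "class_ring :: 'k::field ring" V
  for V :: "('k::field, 'v) module" (structure) +
  fixes U
  assumes sub: "VectorSpace.subspace class_ring U V"
begin

sublocale submod: submodule class_ring U V
  using sub by (simp add: VectorSpace.subspace_def)

text \<open>Makes the coset calculus of additive groups available. Closure under negation comes from
  scaling by -1.\<close>

sublocale abelian_subgroup U V
proof (rule abelian_subgroupI3)
  have "\<ominus> x \<in> U" if "x \<in> U" for x
  proof -
    have "- 1 \<odot> x \<in> U" using that by (intro submod.smult_closed) auto
    moreover have "- 1 \<odot> x = \<ominus> x"
      using that submod.subset smult_minus_1[of x] by (auto simp: class_ring_simps)
    ultimately show ?thesis by (simp only:)
  qed
  then show "additive_subgroup U V"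
    using submod.subset
    by unfold_locales (auto simp: a_inv_def)
qed unfold_locales

lemma carrier_quotient_space: "carrier (quotient_space V U) = (\<lambda>x. U +> x) ` carrier V"
  by (auto simp: quotient_space_def A_RCOSETS_def RCOSETS_def a_r_coset_def)

lemma coset_eq_iff:
  assumes "x \<in> carrier V" "y \<in> carrier V"
  shows "U +> x = U +> y \<longleftrightarrow> x \<ominus> y \<in> U"
proof
  assume "U +> x = U +> y"
  then show "x \<ominus> y \<in> U"
    using assms a_rcos_self[of x] a_rcos_module_imp[of y x] by (simp add: a_minus_def)
next
  assume "x \<ominus> y \<in> U"
  then have "x \<in> U +> y"
    using assms a_rcos_module_rev[of y x] by (simp add: a_minus_def)
  then show "U +> x = U +> y"
    using assms a_repr_independence'[of x y] by simp
qed

text \<open>Scalar multiplication on a quotient and induced maps are defined as unions over all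
  representatives. Such a union is a genuine value as soon as all representatives give the same
  set.\<close>

lemma UN_coset:
  assumes x: "x \<in> carrier V" and g: "\<And>z. z \<in> U +> x \<Longrightarrow> g z = g x"
  shows "(\<Union>z\<in>U +> x. g z) = g x"
  using a_rcos_self[OF x] g by blast

lemma smult_coset:
  assumes x: "x \<in> carrier V"
  shows "(\<Union>z\<in>U +> x. U +> (a \<odot> z)) = U +> (a \<odot> x)"
proof (rule UN_coset[OF x])
  fix z assume z: "z \<in> U +> x"
  then have zc: "z \<in> carrier V" using x by (rule a_elemrcos_carrier[rotated])
  have "a \<odot> z \<ominus> a \<odot> x = a \<odot> (z \<ominus> x)"
    using x zc by (simp add: a_minus_def smult_r_distr smult_r_minus)
  moreover have "z \<ominus> x \<in> U"
    using z x a_rcos_module_imp by (simp add: a_minus_def)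
  ultimately show "U +> (a \<odot> z) = U +> (a \<odot> x)"
    using x zc coset_eq_iff by simp
qed

lemma
  shows vectorspace_quotient_space: "vectorspace class_ring (quotient_space V U)"
    and linear_map_coset: "linear_map class_ring V (quotient_space V U) (\<lambda>x. U +> x)"
proof -
  note * = vectorspace_of_surjection[OF vectorspace_axioms carrier_quotient_space]
  have zero: "\<zero>\<^bsub>quotient_space V U\<^esub> = U +> \<zero>"
    using a_rcos_const by (simp add: quotient_space_def)
  have add: "(U +> x) \<oplus>\<^bsub>quotient_space V U\<^esub> (U +> y) = U +> (x \<oplus> y)"
    if "x \<in> carrier V" "y \<in> carrier V" for x y
    using that by (simp add: quotient_space_def a_rcos_sum)
  have smult: "a \<odot>\<^bsub>quotient_space V U\<^esub> (U +> x) = U +> (a \<odot> x)" if "x \<in> carrier V" for a x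
    using smult_coset[OF that] by (simp add: quotient_space_def)
  show "vectorspace class_ring (quotient_space V U)"
    by (rule *(1)[OF zero add smult])
  show "linear_map class_ring V (quotient_space V U) (\<lambda>x. U +> x)"
    by (rule *(2)[OF zero add smult])
qed

end

text \<open>Representatives of one class differ by an element of \<open>U\<close>, which
  \<open>T\<close> sends into \<open>U'\<close>, so the union is over copies of a single coset.
  Linearity then follows from that of \<open>T\<close> and of the two coset maps.\<close>

lemma
  fixes V :: "('k::field, 'v) module" and W :: "('k, 'w) module"
  assumes V: "space_with_subspace V U" and W: "space_with_subspace W U'"
    and T: "linear_map class_ring V W T" and TU: "T ` U \<subseteq> U'"
  shows induced_map_coset: "\<And>x. x \<in> carrier V \<Longrightarrow>
      (\<Union>z\<in>U +>\<^bsub>V\<^esub> x. U' +>\<^bsub>W\<^esub> T z) = U' +>\<^bsub>W\<^esub> T x"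
    and linear_map_induced_map:
      "linear_map class_ring (quotient_space V U) (quotient_space W U')
         (\<lambda>A. \<Union>z\<in>A. U' +>\<^bsub>W\<^esub> T z)"
proof -
  interpret V: space_with_subspace V U by fact
  interpret W: space_with_subspace W U' by fact
  interpret T: linear_map class_ring V W T by fact
  interpret qV: linear_map class_ring V "quotient_space V U" "\<lambda>x. U +>\<^bsub>V\<^esub> x"
    by (rule V.linear_map_coset)
  interpret qW: linear_map class_ring W "quotient_space W U'" "\<lambda>x. U' +>\<^bsub>W\<^esub> x"
    by (rule W.linear_map_coset)
  show coset: "(\<Union>z\<in>U +>\<^bsub>V\<^esub> x. U' +>\<^bsub>W\<^esub> T z) = U' +>\<^bsub>W\<^esub> T x" if x: "x \<in> carrier V" for x
  proof (rule V.UN_coset[OF x])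
    fix z assume z: "z \<in> U +>\<^bsub>V\<^esub> x"
    then have zc: "z \<in> carrier V" using x by (rule V.a_elemrcos_carrier[rotated])
    have "z \<ominus>\<^bsub>V\<^esub> x \<in> U"
      using z x V.a_rcos_module_imp by (simp add: a_minus_def)
    then have "T (z \<ominus>\<^bsub>V\<^esub> x) \<in> U'" using TU by blast
    then show "U' +>\<^bsub>W\<^esub> T z = U' +>\<^bsub>W\<^esub> T x"
      using x zc by (simp add: W.coset_eq_iff T.f_minus)
  qed
  show "linear_map class_ring (quotient_space V U) (quotient_space W U')
         (\<lambda>A. \<Union>z\<in>A. U' +>\<^bsub>W\<^esub> T z)"
  proof (rule linear_mapI)
    show "vectorspace class_ring (quotient_space V U)" "vectorspace class_ring (quotient_space W U')"
      by (rule V.vectorspace_quotient_space W.vectorspace_quotient_space)+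
    fix A assume "A \<in> carrier (quotient_space V U)"
    then obtain x where x: "A = U +>\<^bsub>V\<^esub> x" "x \<in> carrier V"
      by (auto simp: V.carrier_quotient_space)
    then show "(\<Union>z\<in>A. U' +>\<^bsub>W\<^esub> T z) \<in> carrier (quotient_space W U')"
      using coset qW.f_im by simp
    show "(\<Union>z\<in>a \<odot>\<^bsub>quotient_space V U\<^esub> A. U' +>\<^bsub>W\<^esub> T z) =
        a \<odot>\<^bsub>quotient_space W U'\<^esub> (\<Union>z\<in>A. U' +>\<^bsub>W\<^esub> T z)" for a
      using coset[of "a \<odot>\<^bsub>V\<^esub> x"] coset[of x] qV.f_smult[of a x] qW.f_smult[of a "T x"] x by simp
    fix B assume "B \<in> carrier (quotient_space V U)"
    then obtain y where y: "B = U +>\<^bsub>V\<^esub> y" "y \<in> carrier V"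
      by (auto simp: V.carrier_quotient_space)
    show "(\<Union>z\<in>A \<oplus>\<^bsub>quotient_space V U\<^esub> B. U' +>\<^bsub>W\<^esub> T z) =
        (\<Union>z\<in>A. U' +>\<^bsub>W\<^esub> T z) \<oplus>\<^bsub>quotient_space W U'\<^esub> (\<Union>z\<in>B. U' +>\<^bsub>W\<^esub> T z)"
      using coset[of "x \<oplus>\<^bsub>V\<^esub> y"] coset[of x] coset[of y] qV.f_add[of x y] qW.f_add[of "T x" "T y"] x y
      by simp
  qed
qed

section \<open>Chains with coefficients in a field\<close>

lemma lookup_scale_chain [simp]:
  "Poly_Mapping.lookup (scale_chain a c) s = a * Poly_Mapping.lookup c s"
  by (simp add: scale_chain_def Poly_Mapping.map.rep_eq when_def)

lemma scale_chain_simps [simp]: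
  "scale_chain 0 c = 0" "scale_chain a 0 = 0" "scale_chain 1 c = c"
  "scale_chain a (scale_chain b c) = scale_chain (a * b) c"
  "scale_chain a (Poly_Mapping.single s b) = Poly_Mapping.single s (a * b)"
  by (auto intro!: poly_mapping_eqI simp: lookup_single when_def)

lemma scale_chain_add_left: "scale_chain (a + b) c = scale_chain a c + scale_chain b c"
  by (auto intro!: poly_mapping_eqI simp: lookup_add algebra_simps)

lemma scale_chain_add_right: "scale_chain a (c + d) = scale_chain a c + scale_chain a d"
  by (auto intro!: poly_mapping_eqI simp: lookup_add algebra_simps)

lemma scale_chain_sum: "scale_chain a (sum f I) = (\<Sum>i\<in>I. scale_chain a (f i))"
  by (induction I rule: infinite_finite_induct) (auto simp: scale_chain_add_right)

lemma keys_scale_chain: "Poly_Mapping.keys (scale_chain a c) \<subseteq> Poly_Mapping.keys c"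
  by (auto simp: in_keys_iff)

section \<open>Linear extension from simplices to chains\<close>

lemma kchain_extend_0 [simp]: "kchain_extend b 0 = 0"
  by (simp add: kchain_extend_def)

lemma kchain_extend_zero [simp]: "kchain_extend (\<lambda>s. 0) c = 0"
  by (simp add: kchain_extend_def)

lemma kchain_extend_single [simp]:
  "kchain_extend b (Poly_Mapping.single s a) = scale_chain a (b s)"
  by (simp add: kchain_extend_def)

lemma kchain_extend_add: "kchain_extend b (c + d) = kchain_extend b c + kchain_extend b d"
  unfolding kchain_extend_def
  by (rule setsum_keys_plus_distrib) (auto simp: scale_chain_add_left)

lemma kchain_extend_sum: "kchain_extend b (sum f I) = (\<Sum>i\<in>I. kchain_extend b (f i))"
  by (induction I rule: infinite_finite_induct) (auto simp: kchain_extend_add)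

lemma kchain_extend_scale: "kchain_extend b (scale_chain a c) = scale_chain a (kchain_extend b c)"
proof -
  \<comment> \<open>Scaling by 0 empties the support, so the sum is first enlarged to the keys of
    \<open>c\<close>, where the additional terms vanish.\<close>
  have "kchain_extend b (scale_chain a c) =
      (\<Sum>s\<in>Poly_Mapping.keys c. scale_chain (Poly_Mapping.lookup (scale_chain a c) s) (b s))"
    unfolding kchain_extend_def
    by (rule sum.mono_neutral_left[OF finite_keys keys_scale_chain]) (metis DiffD2 in_keys_iff scale_chain_simps(1))
  then show ?thesis by (simp add: kchain_extend_def scale_chain_sum)
qed

lemma kchain_extend_compose:
  "kchain_extend b (kchain_extend b' c) = kchain_extend (\<lambda>s. kchain_extend b (b' s)) c"
  by (subst (2) kchain_extend_def)
    (simp add: kchain_extend_sum kchain_extend_scale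
      kchain_extend_def[of "\<lambda>s. kchain_extend b (b' s)"])

lemma kchain_extend_cong:
  assumes "\<And>s. s \<in> Poly_Mapping.keys c \<Longrightarrow> b s = b' s"
  shows "kchain_extend b c = kchain_extend b' c"
  using assms by (simp add: kchain_extend_def)

lemma kchain_extend_single_self: "kchain_extend (\<lambda>s. Poly_Mapping.single s 1) c = c"
  by (auto intro!: poly_mapping_eqI
      simp: kchain_extend_def lookup_sum lookup_single when_def in_keys_iff if_distrib cong: if_cong)

lemma keys_kchain_extend:
  "Poly_Mapping.keys (kchain_extend b c) \<subseteq> (\<Union>s\<in>Poly_Mapping.keys c. Poly_Mapping.keys (b s))"
proof
  fix t assume "t \<in> Poly_Mapping.keys (kchain_extend b c)"
  then have "(\<Sum>s\<in>Poly_Mapping.keys c. Poly_Mapping.lookup c s * Poly_Mapping.lookup (b s) t) \<noteq> 0"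
    by (simp add: in_keys_iff kchain_extend_def lookup_sum)
  then obtain s where "s \<in> Poly_Mapping.keys c" "Poly_Mapping.lookup (b s) t \<noteq> 0"
    by (metis (no_types, lifting) mult_zero_right sum.neutral)
  then show "t \<in> (\<Union>s\<in>Poly_Mapping.keys c. Poly_Mapping.keys (b s))"
    by (auto simp: in_keys_iff)
qed

lemma
  shows kchain_boundary_0 [simp]: "kchain_boundary p 0 = 0"
    and kchain_boundary_add: "kchain_boundary p (c + d) = kchain_boundary p c + kchain_boundary p d"
    and kchain_boundary_scale: "kchain_boundary p (scale_chain a c) = scale_chain a (kchain_boundary p c)"
  by (simp_all add: kchain_boundary_def kchain_extend_add kchain_extend_scale)

subsection \<open>The chain complex\<close>

text \<open>That boundaries are cycles is inherited, simplex by simplex, from the library's integral chains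
  along this change of coefficients.\<close>

definition chain_of_frag :: "('s \<Rightarrow>\<^sub>0 int) \<Rightarrow> ('s \<Rightarrow>\<^sub>0 'k::field)" where
  "chain_of_frag = Poly_Mapping.map of_int"

lemma lookup_chain_of_frag [simp]:
  "Poly_Mapping.lookup (chain_of_frag c) s = of_int (Poly_Mapping.lookup c s)"
  by (simp add: chain_of_frag_def Poly_Mapping.map.rep_eq when_def)

lemma
  shows chain_of_frag_0 [simp]: "chain_of_frag 0 = 0"
    and chain_of_frag_add: "chain_of_frag (c + d) = chain_of_frag c + chain_of_frag d"
    and chain_of_frag_diff: "chain_of_frag (c - d) = chain_of_frag c - chain_of_frag d"
    and chain_of_frag_cmul: "chain_of_frag (frag_cmul n c) = scale_chain (of_int n) (chain_of_frag c)"
    and chain_of_frag_of [simp]: "chain_of_frag (frag_of s) = Poly_Mapping.single s 1"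
  by (auto intro!: poly_mapping_eqI
      simp: lookup_add lookup_minus lookup_single when_def)

lemma chain_of_frag_sum: "chain_of_frag (sum f I) = (\<Sum>i\<in>I. chain_of_frag (f i))"
  by (induction I rule: infinite_finite_induct) (auto simp: chain_of_frag_add)

text \<open>Both sides are additive in \<open>c\<close>, and on a single simplex the integral signs
  are mapped to the signs \<open>(-1) ^ i\<close> of the field, whatever its characteristic.\<close>

lemma chain_of_frag_boundary:
  "(chain_of_frag (chain_boundary p c)) = (kchain_boundary p (chain_of_frag c) :: ('a, 'b::field) kchain)"
proof -
  have "Poly_Mapping.keys c \<subseteq> UNIV" by simp
  then show ?thesis
  proof (induction rule: frag_induction)
    case zero
    then show ?case by simp
  next
    case (one s)
    then show ?case
      by (simp add: chain_boundary_of kchain_boundary_def chain_of_frag_sum chain_of_frag_cmul)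
  next
    case (diff a b)
    \<comment> \<open>Additivity is applied to \<open>a = (a - b) + b\<close>, which turns the
      induction step for a difference into one for a sum.\<close>
    have "kchain_boundary p (chain_of_frag a :: ('a, 'b) kchain) =
        kchain_boundary p (chain_of_frag (a - b)) + kchain_boundary p (chain_of_frag b)"
      by (simp add: chain_of_frag_diff flip: kchain_boundary_add)
    with diff show ?case
      by (simp add: chain_boundary_diff chain_of_frag_diff)
  qed
qed

lemma kchain_boundary_boundary:
  assumes c: "Poly_Mapping.keys c \<subseteq> singular_simplex_set (Suc p) S"
  shows "kchain_boundary p (kchain_boundary (Suc p) c) = 0"
proof -
  have *: "kchain_boundary p (kchain_boundary (Suc p) (Poly_Mapping.single s 1)) = 0"
    if "singular_simplex (Suc p) S s" for s
  proof -
    have "chain_boundary p (chain_boundary (Suc p) (frag_of s)) = 0"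
      using that by (intro chain_boundary_boundary_alt) (simp add: singular_chain_of)
    then have "kchain_boundary p (kchain_boundary (Suc p) (chain_of_frag (frag_of s))) = chain_of_frag 0"
      by (metis chain_of_frag_boundary)
    then show ?thesis by simp
  qed
  \<comment> \<open>The double boundary is itself a linear extension, so its vanishing on the
    simplices in the support of \<open>c\<close> suffices.\<close>
  have "kchain_boundary p (kchain_boundary (Suc p) c) =
      kchain_extend (\<lambda>s. kchain_boundary p (kchain_boundary (Suc p) (Poly_Mapping.single s 1))) c"
    by (simp add: kchain_boundary_def kchain_extend_compose del: sum.atMost_Suc)
  also have "\<dots> = kchain_extend (\<lambda>s. 0) c"
    using * c by (intro kchain_extend_cong) auto
  finally show ?thesis by simp
qed

lemma keys_kchain_boundary:
  assumes "Poly_Mapping.keys c \<subseteq> singular_simplex_set (Suc p) S"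
  shows "Poly_Mapping.keys (kchain_boundary (Suc p) c) \<subseteq> singular_simplex_set p S"
proof -
  have "Poly_Mapping.keys (\<Sum>i\<le>Suc p. Poly_Mapping.single (singular_face (Suc p) i s) ((-1) ^ i))
      \<subseteq> singular_simplex_set p S" if "singular_simplex (Suc p) S s" for s
    using singular_simplex_singular_face[OF that]
    by (intro order_trans[OF keys_sum]) (auto split: if_splits)
  then show ?thesis
    using assms unfolding kchain_boundary_def
    by (simp del: sum.atMost_Suc) (intro order_trans[OF keys_kchain_extend], blast)
qed

lemma keys_kchain_map:
  assumes "Poly_Mapping.keys c \<subseteq> singular_simplex_set p S" "continuous_map S T f"
  shows "Poly_Mapping.keys (kchain_map p f c) \<subseteq> singular_simplex_set p T"
  using assms singular_simplex_simplex_map[of p S _ T f] unfolding kchain_map_def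
  by (intro order_trans[OF keys_kchain_extend]) auto

lemma kchain_boundary_kchain_map:
  assumes "Poly_Mapping.keys c \<subseteq> singular_simplex_set (Suc p) S"
  shows "kchain_boundary (Suc p) (kchain_map (Suc p) f c) = kchain_map p f (kchain_boundary (Suc p) c)"
proof -
  \<comment> \<open>Simplices are functions restricted to a standard simplex. The inner restriction
    is harmless because a face inclusion maps into the larger standard simplex.\<close>
  have "singular_face (Suc p) i (simplex_map (Suc p) f s) = simplex_map p f (singular_face (Suc p) i s)"
    if "i \<le> Suc p" for i s
    using that
    using simplical_face_in_standard_simplex[of "Suc p" i]
    by (auto simp: singular_face_def simplex_map_def fun_eq_iff)
  then show ?thesis
    by (simp add: kchain_boundary_def kchain_map_def kchain_extend_compose kchain_extend_sum del: sum.atMost_Suc)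
qed

text \<open>\<open>simplex_map p id\<close> restricts to the standard simplex, so it fixes singular
  simplices but not arbitrary functions; hence the condition on the support. This is what lets
  inclusions act trivially on representatives.\<close>

lemma kchain_map_id:
  assumes "Poly_Mapping.keys c \<subseteq> singular_simplex_set p S"
  shows "kchain_map p id c = c"
proof -
  have "kchain_map p id c = kchain_extend (\<lambda>s. Poly_Mapping.single s 1) c"
    unfolding kchain_map_def
    using assms by (intro kchain_extend_cong) (auto simp: simplex_map_id_gen simp del: simplex_map_id)
  then show ?thesis by (simp add: kchain_extend_single_self)
qed

section \<open>Homology spaces\<close>

lemma vectorspace_chain_space:
  "vectorspace class_ring (chain_space p S :: ('k::field, ('a, 'k) kchain) module)"
proof (rule vs_criteria)
  let ?C = "chain_space p S :: ('k::field, ('a, 'k) kchain) module"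
  show "\<forall>v w. v \<in> carrier ?C \<and> w \<in> carrier ?C \<longrightarrow> v \<oplus>\<^bsub>?C\<^esub> w \<in> carrier ?C"
    using keys_add by (fastforce simp: chain_space_def)
  show "\<forall>v\<in>carrier ?C. \<exists>w\<in>carrier ?C. v \<oplus>\<^bsub>?C\<^esub> w = \<zero>\<^bsub>?C\<^esub>"
    by (auto simp: chain_space_def intro!: exI[of _ "- _"])
  show "\<forall>c v. c \<in> carrier class_ring \<and> v \<in> carrier ?C \<longrightarrow> c \<odot>\<^bsub>?C\<^esub> v \<in> carrier ?C"
    using keys_scale_chain by (fastforce simp: chain_space_def)
qed (auto simp: chain_space_def class_field scale_chain_add_left scale_chain_add_right algebra_simps)

lemma subspace_cycles:
  "VectorSpace.subspace class_ring (cycles p S) (chain_space p S :: ('k::field, ('a, 'k) kchain) module)"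
  using vectorspace_chain_space[of p S, where 'k = 'k]
proof (rule subspaceI)
  let ?C = "chain_space p S :: ('k::field, ('a, 'k) kchain) module"
  interpret vectorspace class_ring ?C by (rule vectorspace_chain_space)
  show "cycles p S \<subseteq> carrier ?C" by (auto simp: cycles_def)
  show "\<zero>\<^bsub>?C\<^esub> \<in> cycles p S"
    using M.zero_closed by (auto simp: cycles_def) (simp add: chain_space_def)
  show "x \<oplus>\<^bsub>?C\<^esub> y \<in> cycles p S" if "x \<in> cycles p S" "y \<in> cycles p S" for x y
    using that M.a_closed[of x y] by (auto simp: cycles_def) (simp add: chain_space_def kchain_boundary_add)
  show "a \<odot>\<^bsub>?C\<^esub> x \<in> cycles p S" if "x \<in> cycles p S" for a x
    using that smult_closed[of a x] by (auto simp: cycles_def) (simp add: chain_space_def kchain_boundary_scale)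
qed

abbreviation cycle_space :: "nat \<Rightarrow> 'a topology \<Rightarrow> ('k::field, ('a, 'k) kchain) module" where
  "cycle_space p S \<equiv> chain_space p S\<lparr>carrier := cycles p S\<rparr>"

lemma vectorspace_cycle_space:
  "vectorspace class_ring (cycle_space p S :: ('k::field, ('a, 'k) kchain) module)"
  by (rule vectorspace.subspace_is_vs[OF vectorspace_chain_space subspace_cycles])

lemma boundaries_subset_cycles: "boundaries p S \<subseteq> cycles p S"
  using kchain_boundary_boundary keys_kchain_boundary
  by (fastforce simp: boundaries_def cycles_def chain_space_def)

lemma space_with_subspace_cycles:
  "space_with_subspace (cycle_space p S :: ('k::field, ('a, 'k) kchain) module) (boundaries p S)"
proof (intro space_with_subspace.intro space_with_subspace_axioms.intro vectorspace_cycle_space subspaceI)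
  let ?C = "chain_space (Suc p) S :: ('k::field, ('a, 'k) kchain) module"
  interpret vectorspace class_ring ?C by (rule vectorspace_chain_space)
  let ?Z = "cycle_space p S :: ('k::field, ('a, 'k) kchain) module"
  show "boundaries p S \<subseteq> carrier ?Z"
    using boundaries_subset_cycles by auto
  have "kchain_boundary (Suc p) \<zero>\<^bsub>?C\<^esub> \<in> boundaries p S"
    unfolding boundaries_def by blast
  then show "\<zero>\<^bsub>?Z\<^esub> \<in> boundaries p S" by (simp add: chain_space_def)
  show "x \<oplus>\<^bsub>?Z\<^esub> y \<in> boundaries p S" if xy: "x \<in> boundaries p S" "y \<in> boundaries p S" for x y
  proof -
    obtain c d where "x = kchain_boundary (Suc p) c" "y = kchain_boundary (Suc p) d"
      "c \<in> carrier ?C" "d \<in> carrier ?C" using xy by (auto simp: boundaries_def)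
    moreover from this have "kchain_boundary (Suc p) (c \<oplus>\<^bsub>?C\<^esub> d) \<in> boundaries p S"
      unfolding boundaries_def by blast
    ultimately show ?thesis by (simp add: chain_space_def kchain_boundary_add)
  qed
  show "a \<odot>\<^bsub>?Z\<^esub> x \<in> boundaries p S" if x: "x \<in> boundaries p S" for a x
  proof -
    obtain c where "x = kchain_boundary (Suc p) c" "c \<in> carrier ?C"
      using x by (auto simp: boundaries_def)
    moreover from this have "kchain_boundary (Suc p) (a \<odot>\<^bsub>?C\<^esub> c) \<in> boundaries p S"
      unfolding boundaries_def by (intro imageI smult_closed) auto
    ultimately show ?thesis by (simp add: chain_space_def kchain_boundary_scale)
  qed
qed

lemma vectorspace_homology_space:
  "vectorspace class_ring (homology_space (K :: 'k::field itself) p S)"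
  unfolding homology_space_def
  by (rule space_with_subspace.vectorspace_quotient_space[OF space_with_subspace_cycles])

section \<open>Induced maps on homology\<close>

lemma kchain_map_cycles:
  assumes f: "continuous_map S T f"
  shows "kchain_map p f ` cycles p S \<subseteq> (cycles p T :: ('b, 'k::field) kchain set)"
proof (cases p)
  \<comment> \<open>In degree 0 every chain is a cycle, so only the support has to be checked; the
    square with the boundary is stated for degrees \<open>Suc p\<close> and
    \<open>p\<close>.\<close>
  case 0
  then show ?thesis
    using keys_kchain_map[OF _ f] by (auto simp: cycles_def chain_space_def kchain_boundary_def)
next
  case (Suc q)
  have "kchain_map p f c \<in> cycles p T" if "c \<in> cycles p S" for c :: "('a, 'k) kchain"
    using that keys_kchain_map[OF _ f, of c p] kchain_boundary_kchain_map[of c q S f]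
    by (simp add: cycles_def chain_space_def Suc) (simp add: kchain_map_def)
  then show ?thesis by blast
qed

lemma kchain_map_boundaries:
  assumes f: "continuous_map S T f"
  shows "kchain_map p f ` boundaries p S \<subseteq> boundaries p T"
proof clarify
  fix x assume "x \<in> boundaries p S"
  then obtain c where c: "x = kchain_boundary (Suc p) c" "c \<in> carrier (chain_space (Suc p) S)"
    by (auto simp: boundaries_def)
  then have "kchain_map p f x = kchain_boundary (Suc p) (kchain_map (Suc p) f c)"
    by (simp add: kchain_boundary_kchain_map[of _ _ S] chain_space_def)
  then show "kchain_map p f x \<in> boundaries p T"
    using c keys_kchain_map[OF _ f, of c "Suc p"] unfolding boundaries_def
    by (intro image_eqI[of _ _ "kchain_map (Suc p) f c"]) (auto simp: chain_space_def)
qed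

text \<open>\<open>homology_space\<close> is a quotient of the cycle space, while
  \<open>homology_map\<close> forms cosets in the chain space. A coset depends only on the addition,
  which the two records share.\<close>

lemma a_r_coset_cycle_space: "A +>\<^bsub>cycle_space p S\<^esub> x = A +>\<^bsub>chain_space p S\<^esub> x"
  by (simp add: a_r_coset_def r_coset_def)

text \<open>An instance of the map induced on quotients: a continuous map sends cycles to cycles and
  boundaries to boundaries.\<close>

lemma
  fixes K :: "'k::field itself"
  assumes f: "continuous_map S T f"
  shows linear_map_homology_map:
      "linear_map class_ring (homology_space K p S) (homology_space K p T) (homology_map K p T f)"
    and homology_map_coset: "\<And>z :: ('a, 'k) kchain. z \<in> cycles p S \<Longrightarrow>
      homology_map K p T f (boundaries p S +>\<^bsub>chain_space p S\<^esub> z) =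
        boundaries p T +>\<^bsub>chain_space p T\<^esub> kchain_map p f z"
proof -
  let ?Z = "cycle_space p S :: ('k::field, ('a, 'k) kchain) module"
  have T: "linear_map class_ring ?Z (cycle_space p T) (kchain_map p f)"
    by (rule linear_mapI)
      (use kchain_map_cycles[OF f] in \<open>auto simp: vectorspace_cycle_space\<close>,
        auto simp: chain_space_def kchain_map_def kchain_extend_add kchain_extend_scale)
  have map: "homology_map K p T f =
      (\<lambda>A. \<Union>z\<in>A. boundaries p T +>\<^bsub>cycle_space p T :: ('k, _) module\<^esub> kchain_map p f z)"
    by (simp add: homology_map_def fun_eq_iff a_r_coset_cycle_space)
  note induced = space_with_subspace_cycles space_with_subspace_cycles T kchain_map_boundaries[OF f]
  show "linear_map class_ring (homology_space K p S) (homology_space K p T) (homology_map K p T f)"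
    unfolding map homology_space_def by (rule linear_map_induced_map[OF induced])
  show "homology_map K p T f (boundaries p S +>\<^bsub>chain_space p S\<^esub> z) =
        boundaries p T +>\<^bsub>chain_space p T\<^esub> kchain_map p f z" if "z \<in> cycles p S" for z :: "('a, 'k) kchain"
    using induced_map_coset[OF induced, of z] that
    by (simp add: map a_r_coset_cycle_space)
qed

lemma carrier_homology_space:
  "carrier (homology_space (K :: 'k::field itself) p S) =
     (\<lambda>z. boundaries p S +>\<^bsub>chain_space p S\<^esub> z) ` cycles p S"
  unfolding homology_space_def
  by (simp add: space_with_subspace.carrier_quotient_space[OF space_with_subspace_cycles]
      a_r_coset_cycle_space)

lemma homology_map_id:
  assumes "A \<in> carrier (homology_space (K :: 'k::field itself) p S)"
  shows "homology_map K p S id A = A"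
proof -
  obtain z :: "('a, 'k) kchain" where z: "z \<in> cycles p S" "A = boundaries p S +>\<^bsub>chain_space p S\<^esub> z"
    using assms by (auto simp: carrier_homology_space)
  then have "kchain_map p id z = z"
    by (intro kchain_map_id) (auto simp: cycles_def chain_space_def)
  then show ?thesis
    using z homology_map_coset[of S S id z p K] by simp
qed

text \<open>Inclusions leave a representing chain unchanged, so all three maps are evaluated on one
  chain \<open>z\<close>, which is a cycle in \<open>R\<close> and also in \<open>S\<close>.\<close>

lemma homology_map_id_comp:
  assumes "A \<in> carrier (homology_space (K :: 'k::field itself) p R)"
    and RS: "continuous_map R S id" and ST: "continuous_map S T id"
  shows "homology_map K p T id (homology_map K p S id A) = homology_map K p T id A"
proof -
  obtain z :: "('a, 'k) kchain" where z: "z \<in> cycles p R" "A = boundaries p R +>\<^bsub>chain_space p R\<^esub> z"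
    using assms by (auto simp: carrier_homology_space)
  then have "kchain_map p id z = z"
    by (intro kchain_map_id) (auto simp: cycles_def chain_space_def)
  moreover from this have "z \<in> cycles p S" using kchain_map_cycles[OF RS, of p] z by force
  moreover have "continuous_map R T id" using continuous_map_compose[OF RS ST] by simp
  ultimately show ?thesis
    using z homology_map_coset[OF RS, of z p K] homology_map_coset[OF ST, of z p K]
      homology_map_coset[of R T id z p K] by simp
qed

section \<open>Limit and colimit over a linear graph\<close>

lemma vectorspace_product_space:
  fixes W :: "'v \<Rightarrow> ('k::field, 'w) module"
  assumes W: "\<And>v. v \<in> verts G \<Longrightarrow> vectorspace class_ring (W v)"
  shows "vectorspace class_ring (product_space G W)"
proof (rule vs_criteria)
  let ?P = "product_space G W"
  have mod: "module class_ring (W v)" if "v \<in> verts G" for v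
    using W[OF that] by (simp add: vectorspace_def)
  then have ag: "abelian_group (W v)" if "v \<in> verts G" for v
    using that by (simp add: Module.module_def)
  then have am: "abelian_monoid (W v)" if "v \<in> verts G" for v
    using that by (simp add: abelian_group_def)
  have closed: "x v \<oplus>\<^bsub>W v\<^esub> y v \<in> carrier (W v)" "a \<odot>\<^bsub>W v\<^esub> x v \<in> carrier (W v)"
    if "v \<in> verts G" "x \<in> carrier ?P" "y \<in> carrier ?P" for v x y and a :: 'k
    using that abelian_monoid.a_closed[OF am] module.smult_closed[OF mod]
    by (auto simp: product_space_def PiE_iff)
  show "field (class_ring :: 'k ring)" by (rule class_field)
  show "\<zero>\<^bsub>?P\<^esub> \<in> carrier ?P"
    using abelian_monoid.zero_closed[OF am] by (auto simp: product_space_def)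
  show "\<forall>x y. x \<in> carrier ?P \<and> y \<in> carrier ?P \<longrightarrow> x \<oplus>\<^bsub>?P\<^esub> y \<in> carrier ?P"
    using closed by (auto simp: product_space_def)
  show "\<forall>x\<in>carrier ?P. \<exists>y\<in>carrier ?P. x \<oplus>\<^bsub>?P\<^esub> y = \<zero>\<^bsub>?P\<^esub>"
  proof
    fix x assume "x \<in> carrier ?P"
    then show "\<exists>y\<in>carrier ?P. x \<oplus>\<^bsub>?P\<^esub> y = \<zero>\<^bsub>?P\<^esub>"
      using abelian_group.a_inv_closed[OF ag] abelian_group.r_neg[OF ag]
      by (intro bexI[of _ "\<lambda>v\<in>verts G. \<ominus>\<^bsub>W v\<^esub> x v"])
        (auto simp: product_space_def PiE_iff intro!: restrict_ext)
  qed
  show "\<forall>a x. a \<in> carrier class_ring \<and> x \<in> carrier ?P \<longrightarrow> a \<odot>\<^bsub>?P\<^esub> x \<in> carrier ?P"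
    using closed by (auto simp: product_space_def)
  show "\<forall>x y. x \<in> carrier ?P \<and> y \<in> carrier ?P \<longrightarrow> x \<oplus>\<^bsub>?P\<^esub> y = y \<oplus>\<^bsub>?P\<^esub> x"
    using abelian_monoid.a_comm[OF am] by (auto simp: product_space_def PiE_iff intro!: restrict_ext)
  show "\<forall>x y z. x \<in> carrier ?P \<and> y \<in> carrier ?P \<and> z \<in> carrier ?P \<longrightarrow>
      x \<oplus>\<^bsub>?P\<^esub> y \<oplus>\<^bsub>?P\<^esub> z = x \<oplus>\<^bsub>?P\<^esub> (y \<oplus>\<^bsub>?P\<^esub> z)"
    using abelian_monoid.a_assoc[OF am] by (auto simp: product_space_def PiE_iff intro!: restrict_ext)
  show "\<forall>x\<in>carrier ?P. x \<oplus>\<^bsub>?P\<^esub> \<zero>\<^bsub>?P\<^esub> = x"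
    using abelian_monoid.r_zero[OF am]
    by (auto simp: product_space_def PiE_iff intro!: extensionalityI[of _ "verts G"])
  show "\<forall>a b x. a \<in> carrier class_ring \<and> b \<in> carrier class_ring \<and> x \<in> carrier ?P \<longrightarrow>
      (a \<otimes>\<^bsub>class_ring\<^esub> b) \<odot>\<^bsub>?P\<^esub> x = a \<odot>\<^bsub>?P\<^esub> (b \<odot>\<^bsub>?P\<^esub> x)"
    using module.smult_assoc1[OF mod] by (auto simp: product_space_def PiE_iff intro!: restrict_ext)
  show "\<forall>x\<in>carrier ?P. \<one>\<^bsub>class_ring\<^esub> \<odot>\<^bsub>?P\<^esub> x = x"
    using module.smult_one[OF mod]
    by (auto simp: product_space_def PiE_iff intro!: extensionalityI[of _ "verts G"])
  show "\<forall>a b x. a \<in> carrier class_ring \<and> b \<in> carrier class_ring \<and> x \<in> carrier ?P \<longrightarrow>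
      (a \<oplus>\<^bsub>class_ring\<^esub> b) \<odot>\<^bsub>?P\<^esub> x = a \<odot>\<^bsub>?P\<^esub> x \<oplus>\<^bsub>?P\<^esub> b \<odot>\<^bsub>?P\<^esub> x"
    using module.smult_l_distr[OF mod] by (auto simp: product_space_def PiE_iff intro!: restrict_ext)
  show "\<forall>a x y. a \<in> carrier class_ring \<and> x \<in> carrier ?P \<and> y \<in> carrier ?P \<longrightarrow>
      a \<odot>\<^bsub>?P\<^esub> (x \<oplus>\<^bsub>?P\<^esub> y) = a \<odot>\<^bsub>?P\<^esub> x \<oplus>\<^bsub>?P\<^esub> a \<odot>\<^bsub>?P\<^esub> y"
    using module.smult_r_distr[OF mod] by (auto simp: product_space_def PiE_iff intro!: restrict_ext)
qed

text \<open>Detaches the induced subgraph of a filtration graph from topology: \<open>W\<close> and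
  \<open>F\<close> are arbitrary vector spaces and linear maps along consecutive vertices.\<close>

locale linear_chain =
  fixes I :: "(nat, nat \<times> nat) pre_digraph"
    and W :: "nat \<Rightarrow> ('k::field, 'w) module" and F :: "nat \<times> nat \<Rightarrow> 'w \<Rightarrow> 'w" and i j :: nat
  assumes ij: "i \<le> j"
    and graph: "verts I = {i..j}" "arcs I = {(l, Suc l) | l. i \<le> l \<and> l < j}"
      "tail I = fst" "head I = snd"
    and vs: "\<And>l. i \<le> l \<Longrightarrow> l \<le> j \<Longrightarrow> vectorspace class_ring (W l)"
    and linear_F: "\<And>l. i \<le> l \<Longrightarrow> l < j \<Longrightarrow> linear_map class_ring (W l) (W (Suc l)) (F (l, Suc l))"
begin

text \<open>Written with \<open>path_map\<close> so that it is literally the map which the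
  preradical attaches to the walk from \<open>a\<close> to \<open>b\<close>.\<close>

definition trans :: "nat \<Rightarrow> nat \<Rightarrow> 'w \<Rightarrow> 'w" where
  "trans a b = path_map F (map (\<lambda>l. (l, Suc l)) [a..<b])"

lemma trans_self [simp]: "trans a a w = w"
  by (simp add: trans_def path_map_def)

lemma trans_Suc: "a \<le> b \<Longrightarrow> trans a (Suc b) w = F (b, Suc b) (trans a b w)"
  by (simp add: trans_def path_map_def)

text \<open>Peels off the first arc, where \<open>trans_Suc\<close> peels off the last. This is the
  form in which the colimit relations are seen to vanish at \<open>j\<close>.\<close>

lemma trans_step: "a < b \<Longrightarrow> trans (Suc a) b (F (a, Suc a) w) = trans a b w"
  by (simp add: trans_def path_map_def upt_conv_Cons)

lemma linear_trans:
  assumes "i \<le> a" "a \<le> b" "b \<le> j"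
  shows "linear_map class_ring (W a) (W b) (trans a b)"
  using assms(2,3)
proof (induction b rule: dec_induct)
  case base
  have "trans a a = id" by auto
  then show ?case using linear_map_id[OF vs[of a]] assms by (simp only:)
next
  case (step b)
  have "trans a (Suc b) = F (b, Suc b) \<circ> trans a b"
    using step by (auto simp: trans_Suc)
  then show ?case
    using linear_map_comp[OF step.IH linear_F[of b]] step assms by (simp only:)
qed

lemma trans_closed:
  assumes "i \<le> a" "a \<le> b" "b \<le> j" "w \<in> carrier (W a)"
  shows "trans a b w \<in> carrier (W b)"
  using linear_map_closed[OF linear_trans] assms by blast

lemma vectorspace_product: "vectorspace class_ring (product_space I W)"
  by (rule vectorspace_product_space) (simp add: graph vs)

sublocale P: vectorspace class_ring "product_space I W"
  by (rule vectorspace_product)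

lemma zero_closed: "l \<in> {i..j} \<Longrightarrow> \<zero>\<^bsub>W l\<^esub> \<in> carrier (W l)"
  by (rule abelian_monoid.zero_closed)
    (use vs[of l] in \<open>simp add: vectorspace_def Module.module_def abelian_group_def\<close>)

subsection \<open>The limit\<close>

lemma mem_lim_space:
  "x \<in> carrier (lim_space I W F) \<longleftrightarrow>
     x \<in> (\<Pi>\<^sub>E l\<in>{i..j}. carrier (W l)) \<and> (\<forall>l. i \<le> l \<and> l < j \<longrightarrow> F (l, Suc l) (x l) = x (Suc l))"
  by (auto simp: lim_space_def product_space_def graph)

lemma lim_space_trans:
  assumes "x \<in> carrier (lim_space I W F)" "i \<le> a" "a \<le> b" "b \<le> j"
  shows "trans a b (x a) = x b"
  using assms(3,4)
proof (induction b rule: dec_induct)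
  case (step b)
  then show ?case using assms by (auto simp: trans_Suc mem_lim_space)
qed simp

lemma subspace_lim:
  "VectorSpace.subspace class_ring (carrier (lim_space I W F)) (product_space I W)"
proof (rule subspaceI[OF vectorspace_product])
  let ?P = "product_space I W" and ?L = "carrier (lim_space I W F)"
  have mem: "x \<in> ?L \<longleftrightarrow> x \<in> carrier ?P \<and> (\<forall>l. i \<le> l \<and> l < j \<longrightarrow> F (l, Suc l) (x l) = x (Suc l))" for x
    by (auto simp: lim_space_def graph)
  show "?L \<subseteq> carrier ?P" by (auto simp: mem)
  show "\<zero>\<^bsub>?P\<^esub> \<in> ?L"
    using P.M.zero_closed linear_map_zero[OF linear_F] by (auto simp: mem) (auto simp: product_space_def graph)
  show "x \<oplus>\<^bsub>?P\<^esub> y \<in> ?L" if "x \<in> ?L" "y \<in> ?L" for x y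
    using that P.M.a_closed[of x y] linear_map_add[OF linear_F]
    by (auto simp: mem) (auto simp: product_space_def graph PiE_iff)
  show "a \<odot>\<^bsub>?P\<^esub> x \<in> ?L" if "x \<in> ?L" for a x
    using that P.smult_closed[of a x] linear_map_smult[OF linear_F]
    by (auto simp: mem) (auto simp: product_space_def graph PiE_iff)
qed

lemma vectorspace_lim: "vectorspace class_ring (lim_space I W F)"
proof -
  have "lim_space I W F = product_space I W\<lparr>carrier := carrier (lim_space I W F)\<rparr>"
    by (simp add: lim_space_def)
  then show ?thesis
    using P.subspace_is_vs[OF subspace_lim] by simp
qed

lemma bij_lim_proj: "bij_betw (lim_proj i) (carrier (lim_space I W F)) (carrier (W i))"
\<comment> \<open>The inverse propagates a vector at the source along the chain, which yields a
  compatible family by \<open>trans_Suc\<close>.\<close>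
proof (rule bij_betwI[where g = "\<lambda>w. \<lambda>l\<in>{i..j}. trans i l w"])
  show "lim_proj i \<in> carrier (lim_space I W F) \<rightarrow> carrier (W i)"
    using ij by (auto simp: lim_proj_def mem_lim_space PiE_iff)
  show "(\<lambda>w. \<lambda>l\<in>{i..j}. trans i l w) \<in> carrier (W i) \<rightarrow> carrier (lim_space I W F)"
    by (auto simp: mem_lim_space trans_closed trans_Suc)
  show "(\<lambda>l\<in>{i..j}. trans i l (lim_proj i x)) = x" if "x \<in> carrier (lim_space I W F)" for x
    using that lim_space_trans[OF that]
    by (intro extensionalityI[of _ "{i..j}"]) (auto simp: lim_proj_def mem_lim_space PiE_iff)
qed (use ij in \<open>auto simp: lim_proj_def\<close>)

lemma vs_iso_lim_proj: "vs_iso (lim_space I W F) (W i) (lim_proj i)"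
  unfolding vs_iso_def
proof (intro conjI bij_lim_proj linear_mapI vectorspace_lim)
  show "vectorspace class_ring (W i)" using vs ij by simp
  show "lim_proj i x \<in> carrier (W i)" if "x \<in> carrier (lim_space I W F)" for x
    using that ij by (auto simp: lim_proj_def mem_lim_space PiE_iff)
qed (use ij in \<open>auto simp: lim_proj_def lim_space_def product_space_def graph\<close>)

subsection \<open>The colimit\<close>

abbreviation inj where "inj \<equiv> direct_sum_inj I W"

abbreviation R where "R \<equiv> colim_relations I W F"

text \<open>There are finitely many vertices, so every family has finite support.\<close>

lemma direct_sum_space_eq: "direct_sum_space I W = product_space I W"
  by (simp add: direct_sum_space_def product_space_def graph)

lemma linear_inj:
  assumes "l \<in> {i..j}"
  shows "linear_map class_ring (W l) (product_space I W) (inj l)"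
proof (rule linear_mapI)
  show "vectorspace class_ring (W l)" using assms vs by simp
  have mod: "module class_ring (W v)" if "v \<in> {i..j}" for v
    using that vs by (simp add: vectorspace_def)
  then have am: "abelian_monoid (W v)" if "v \<in> {i..j}" for v
    using that by (simp add: Module.module_def abelian_group_def)
  show "inj l w \<in> carrier (product_space I W)" if "w \<in> carrier (W l)" for w
    using that zero_closed by (auto simp: direct_sum_inj_def product_space_def graph)
  show "inj l (x \<oplus>\<^bsub>W l\<^esub> y) = inj l x \<oplus>\<^bsub>product_space I W\<^esub> inj l y" for x y
    using abelian_monoid.r_zero[OF am] zero_closed
    by (auto simp: direct_sum_inj_def product_space_def graph intro!: restrict_ext)
  show "inj l (a \<odot>\<^bsub>W l\<^esub> x) = a \<odot>\<^bsub>product_space I W\<^esub> inj l x" for a x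
    using module.smult_r_null[OF mod]
    by (auto simp: direct_sum_inj_def product_space_def graph intro!: restrict_ext)
qed (rule vectorspace_product)

lemma inj_closed: "l \<in> {i..j} \<Longrightarrow> w \<in> carrier (W l) \<Longrightarrow> inj l w \<in> carrier (product_space I W)"
  using linear_map_closed[OF linear_inj] by blast

lemma R_eq: "R = module.span class_ring (product_space I W)
    {inj l w \<ominus>\<^bsub>product_space I W\<^esub> inj (Suc l) (F (l, Suc l) w) | l w.
       i \<le> l \<and> l < j \<and> w \<in> carrier (W l)}"
  unfolding colim_relations_def direct_sum_space_eq graph
proof (intro arg_cong[where f = "module.span class_ring (product_space I W)"] Collect_cong)
  fix x
  let ?P = "\<lambda>e w. x = inj (fst e) w \<ominus>\<^bsub>product_space I W\<^esub> inj (snd e) (F e w) \<and> w \<in> carrier (W (fst e))"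
  have "(\<exists>e w. e \<in> {(l, Suc l) | l. i \<le> l \<and> l < j} \<and> ?P e w) \<longleftrightarrow>
      (\<exists>l w. i \<le> l \<and> l < j \<and> ?P (l, Suc l) w)"
    by blast
  then show "(\<exists>e w. x = inj (fst e) w \<ominus>\<^bsub>product_space I W\<^esub> inj (snd e) (F e w) \<and>
        e \<in> {(l, Suc l) | l. i \<le> l \<and> l < j} \<and> w \<in> carrier (W (fst e))) \<longleftrightarrow>
      (\<exists>l w. x = inj l w \<ominus>\<^bsub>product_space I W\<^esub> inj (Suc l) (F (l, Suc l) w) \<and>
        i \<le> l \<and> l < j \<and> w \<in> carrier (W l))"
    by (simp only: fst_conv snd_conv conj_ac)
qed

lemma relation_closed:
  "{inj l w \<ominus>\<^bsub>product_space I W\<^esub> inj (Suc l) (F (l, Suc l) w) | l w.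
     i \<le> l \<and> l < j \<and> w \<in> carrier (W l)} \<subseteq> carrier (product_space I W)"
proof clarify
  fix l w assume l: "i \<le> l" "l < j" "w \<in> carrier (W l)"
  show "inj l w \<ominus>\<^bsub>product_space I W\<^esub> inj (Suc l) (F (l, Suc l) w) \<in> carrier (product_space I W)"
    by (rule P.M.minus_closed; rule inj_closed) (use l linear_map_closed[OF linear_F[OF l(1,2)] l(3)] in auto)
qed

sublocale PR: space_with_subspace "product_space I W" R
  by (intro space_with_subspace.intro space_with_subspace_axioms.intro vectorspace_product)
    (unfold R_eq, rule P.span_is_subspace[OF relation_closed])

lemma colim_space_eq: "colim_space I W F = quotient_space (product_space I W) R"
  by (simp add: colim_space_def direct_sum_space_eq)

lemma colim_inj_eq: "colim_inj I W F l = (\<lambda>x. R +>\<^bsub>product_space I W\<^esub> x) \<circ> inj l"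
  by (simp add: colim_inj_def direct_sum_space_eq fun_eq_iff)

lemma linear_colim_inj:
  assumes "l \<in> {i..j}"
  shows "linear_map class_ring (W l) (colim_space I W F) (colim_inj I W F l)"
  unfolding colim_space_eq colim_inj_eq
  by (rule linear_map_comp[OF linear_inj[OF assms] PR.linear_map_coset])

lemma colim_inj_step:
  assumes "i \<le> l" "l < j" "w \<in> carrier (W l)"
  shows "colim_inj I W F (Suc l) (F (l, Suc l) w) = colim_inj I W F l w"
proof -
  have "inj l w \<ominus>\<^bsub>product_space I W\<^esub> inj (Suc l) (F (l, Suc l) w) \<in> R"
    unfolding R_eq using assms by (intro subsetD[OF P.in_own_span[OF relation_closed]]) blast
  moreover have "F (l, Suc l) w \<in> carrier (W (Suc l))"
    using linear_map_closed[OF linear_F] assms by blast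
  ultimately have "R +>\<^bsub>product_space I W\<^esub> inj l w = R +>\<^bsub>product_space I W\<^esub> inj (Suc l) (F (l, Suc l) w)"
    using assms by (subst PR.coset_eq_iff) (auto intro!: inj_closed)
  then show ?thesis by (simp add: colim_inj_eq)
qed

lemma colim_inj_trans:
  assumes "i \<le> a" "a \<le> b" "b \<le> j" "w \<in> carrier (W a)"
  shows "colim_inj I W F b (trans a b w) = colim_inj I W F a w"
  using assms(2,3)
proof (induction b rule: dec_induct)
  case (step b)
  then show ?case
    using assms trans_closed[of a b w] by (simp add: trans_Suc colim_inj_step)
qed simp

text \<open>Induction on a set \<open>S\<close> containing the support: splitting off the component
  at \<open>l\<close> leaves a family supported in the smaller set, and the component split off can
  be moved to \<open>j\<close> without changing its class.\<close>

lemma coset_in_range_colim_inj: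
  assumes "finite S" "S \<subseteq> {i..j}" "x \<in> carrier (product_space I W)"
    "\<And>l. l \<in> {i..j} - S \<Longrightarrow> x l = \<zero>\<^bsub>W l\<^esub>"
  shows "R +>\<^bsub>product_space I W\<^esub> x \<in> colim_inj I W F j ` carrier (W j)"
  using assms
proof (induction S arbitrary: x rule: finite_induct)
  case empty
  have "x = inj j \<zero>\<^bsub>W j\<^esub>"
    using empty by (auto simp: product_space_def direct_sum_inj_def graph PiE_iff
        intro!: extensionalityI[of _ "{i..j}"])
  then have "R +>\<^bsub>product_space I W\<^esub> x = colim_inj I W F j \<zero>\<^bsub>W j\<^esub>"
    by (simp add: colim_inj_eq)
  then show ?case using zero_closed[of j] ij by auto
next
  case (insert l S)
  note c = linear_colim_inj[of j]
  interpret q: linear_map class_ring "product_space I W" "colim_space I W F" "\<lambda>x. R +>\<^bsub>product_space I W\<^esub> x"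
    unfolding colim_space_eq by (rule PR.linear_map_coset)
  have l: "l \<in> {i..j}" and xl: "x l \<in> carrier (W l)"
    using insert.prems by (auto simp: product_space_def graph)
  let ?y = "x(l := \<zero>\<^bsub>W l\<^esub>)"
  have y: "?y \<in> carrier (product_space I W)"
    using insert.prems l zero_closed by (auto simp: product_space_def graph PiE_iff extensional_def)
  have "R +>\<^bsub>product_space I W\<^esub> ?y \<in> colim_inj I W F j ` carrier (W j)"
    using insert.prems by (intro insert.IH[OF _ y]) auto
  then obtain w where w: "w \<in> carrier (W j)" "R +>\<^bsub>product_space I W\<^esub> ?y = colim_inj I W F j w"
    by blast
  have am: "abelian_monoid (W v)" if "v \<in> {i..j}" for v
    using that vs by (simp add: vectorspace_def Module.module_def abelian_group_def)
  have "x = inj l (x l) \<oplus>\<^bsub>product_space I W\<^esub> ?y"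
    using insert.prems l xl abelian_monoid.r_zero[OF am] abelian_monoid.l_zero[OF am]
    by (auto simp: product_space_def direct_sum_inj_def graph PiE_iff
        intro!: extensionalityI[of _ "{i..j}"])
  then have "R +>\<^bsub>product_space I W\<^esub> x =
      (R +>\<^bsub>product_space I W\<^esub> inj l (x l)) \<oplus>\<^bsub>colim_space I W F\<^esub> (R +>\<^bsub>product_space I W\<^esub> ?y)"
    using q.f_add[OF inj_closed[OF l xl] y] by simp
  also have "R +>\<^bsub>product_space I W\<^esub> inj l (x l) = colim_inj I W F j (trans l j (x l))"
    using colim_inj_trans[of l j "x l"] l xl by (simp add: colim_inj_eq)
  also have "\<dots> \<oplus>\<^bsub>colim_space I W F\<^esub> (R +>\<^bsub>product_space I W\<^esub> ?y) =
      colim_inj I W F j (trans l j (x l) \<oplus>\<^bsub>W j\<^esub> w)"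
    using w trans_closed[of l j "x l"] l xl linear_map_add[OF c, of "trans l j (x l)" w] by simp
  finally show ?case
    using w trans_closed[of l j "x l"] l xl abelian_monoid.a_closed[OF am, of j] by auto
qed

text \<open>\<open>push m\<close> carries all components at the vertices \<open>i, \<dots>, i + m\<close> to the vertex \<open>i + m\<close> and adds them
  up. For \<open>i + m = j\<close> it kills the colimit relations and is left inverse to the inclusion of \<open>W j\<close>.\<close>

primrec push :: "nat \<Rightarrow> (nat \<Rightarrow> 'w) \<Rightarrow> 'w" where
  "push 0 x = x i"
| "push (Suc m) x = F (i + m, Suc (i + m)) (push m x) \<oplus>\<^bsub>W (Suc (i + m))\<^esub> x (Suc (i + m))"

lemma linear_push:
  assumes "i + m \<le> j"
  shows "linear_map class_ring (product_space I W) (W (i + m)) (push m)"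
  using assms
proof (induction m)
  case 0
  show ?case
    by (rule linear_mapI) (use 0 vs[of i] vectorspace_product in
        \<open>auto simp: product_space_def graph\<close>)
next
  case (Suc m)
  let ?l = "Suc (i + m)"
  have p: "linear_map class_ring (product_space I W) (W (i + m)) (push m)"
    using Suc by simp
  have F: "linear_map class_ring (W (i + m)) (W ?l) (F (i + m, ?l))"
    using Suc by (intro linear_F) auto
  note Fp = linear_map_comp[OF p F]
  interpret Wl: vectorspace class_ring "W ?l"
    using vs Suc by simp
  have x: "x ?l \<in> carrier (W ?l)" if "x \<in> carrier (product_space I W)" for x
    using that Suc by (auto simp: product_space_def graph)
  have "linear_map class_ring (product_space I W) (W ?l) (push (Suc m))"
  proof (rule linear_mapI)
    fix x assume X: "x \<in> carrier (product_space I W)"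
    have FX: "F (i + m, ?l) (push m x) \<in> carrier (W ?l)"
      using linear_map_closed[OF Fp X] by simp
    then show "push (Suc m) x \<in> carrier (W ?l)" using x X by simp
    have "(a \<odot>\<^bsub>product_space I W\<^esub> x) ?l = a \<odot>\<^bsub>W ?l\<^esub> x ?l" for a
      using Suc by (simp add: product_space_def graph)
    then show "push (Suc m) (a \<odot>\<^bsub>product_space I W\<^esub> x) = a \<odot>\<^bsub>W ?l\<^esub> push (Suc m) x" for a
      using x X FX linear_map_smult[OF Fp X, of a] Wl.smult_r_distr[of a "F (i + m, ?l) (push m x)" "x ?l"]
      by simp
    fix y assume Y: "y \<in> carrier (product_space I W)"
    have "(x \<oplus>\<^bsub>product_space I W\<^esub> y) ?l = x ?l \<oplus>\<^bsub>W ?l\<^esub> y ?l"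
      using Suc by (simp add: product_space_def graph)
    then show "push (Suc m) (x \<oplus>\<^bsub>product_space I W\<^esub> y) = push (Suc m) x \<oplus>\<^bsub>W ?l\<^esub> push (Suc m) y"
      using x X Y FX linear_map_add[OF Fp X Y] linear_map_closed[OF Fp Y] by (simp add: Wl.M.a_ac)
  qed (use vectorspace_product Wl.vectorspace_axioms in auto)
  then show ?case by (simp only: add_Suc_right)
qed

text \<open>Before vertex \<open>l\<close> is reached only zeros are carried and added; at
  \<open>l\<close> the vector \<open>w\<close> enters; beyond \<open>l\<close> it is transported
  while the later components add zeros.\<close>

lemma push_inj:
  assumes "i \<le> l" "l \<le> j" "w \<in> carrier (W l)" "i + m \<le> j"
  shows "push m (inj l w) = (if l \<le> i + m then trans l (i + m) w else \<zero>\<^bsub>W (i + m)\<^esub>)"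
  using assms(4)
proof (induction m)
  case 0
  then show ?case using assms by (auto simp: direct_sum_inj_def graph)
next
  case (Suc m)
  interpret Wl: vectorspace class_ring "W (Suc (i + m))"
    using vs Suc by simp
  have F: "linear_map class_ring (W (i + m)) (W (Suc (i + m))) (F (i + m, Suc (i + m)))"
    using Suc by (intro linear_F) auto
  consider "l \<le> i + m" | "l = Suc (i + m)" | "l > Suc (i + m)" by linarith
  then show ?case
  proof cases
    case 1
    then show ?thesis
      using Suc assms trans_closed[of l "Suc (i + m)" w]
      by (simp add: direct_sum_inj_def graph trans_Suc)
  qed (use Suc assms linear_map_zero[OF F] in \<open>simp_all add: direct_sum_inj_def graph\<close>)
qed

text \<open>Surjectivity is \<open>coset_in_range_colim_inj\<close> with all vertices as support.
  For injectivity, \<open>\<Phi>\<close> vanishes on \<open>R\<close> and recovers a vector placed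
  at \<open>j\<close>.\<close>

lemma bij_colim_inj: "bij_betw (colim_inj I W F j) (carrier (W j)) (carrier (colim_space I W F))"
proof -
  define \<Phi> where "\<Phi> = push (j - i)"
  interpret Wj: vectorspace class_ring "W j"
    using vs ij by simp
  interpret Phi: linear_map class_ring "product_space I W" "W j" \<Phi>
    using linear_push[of "j - i"] ij by (simp add: \<Phi>_def)
  have Phi_inj: "\<Phi> (inj l w) = trans l j w" if "i \<le> l" "l \<le> j" "w \<in> carrier (W l)" for l w
    using push_inj[of l w "j - i"] that ij by (simp add: \<Phi>_def)
  \<comment> \<open>Both terms of a relation reach \<open>j\<close> as the same vector: transporting
    \<open>w\<close> from \<open>l\<close> begins with the arc already applied in the second
    term.\<close>
  have "inj l w \<ominus>\<^bsub>product_space I W\<^esub> inj (Suc l) (F (l, Suc l) w) \<in> Phi.ker"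
    if "i \<le> l" "l < j" "w \<in> carrier (W l)" for l w
  proof -
    have Fw: "F (l, Suc l) w \<in> carrier (W (Suc l))"
      using linear_map_closed[OF linear_F] that by blast
    have c: "inj l w \<in> carrier (product_space I W)"
      "inj (Suc l) (F (l, Suc l) w) \<in> carrier (product_space I W)"
      using that Fw by (auto intro!: inj_closed)
    then have "\<Phi> (inj l w \<ominus>\<^bsub>product_space I W\<^esub> inj (Suc l) (F (l, Suc l) w)) = \<zero>\<^bsub>W j\<^esub>"
      using that Fw trans_closed[of l j w]
      by (simp add: Phi_inj trans_step a_minus_def Wj.M.r_neg)
    then show ?thesis
      using c by (simp add: Phi.ker_def)
  qed
  \<comment> \<open>The kernel is a submodule, so it contains the span of the generators.\<close>
  then have "R \<subseteq> Phi.ker"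
    unfolding R_eq by (intro P.span_is_subset Phi.ker_is_submodule) blast
  then have "inj_on (colim_inj I W F j) (carrier (W j))"
  proof (intro inj_onI)
    fix x y assume xy: "x \<in> carrier (W j)" "y \<in> carrier (W j)"
      and "colim_inj I W F j x = colim_inj I W F j y"
    then have "inj j x \<ominus>\<^bsub>product_space I W\<^esub> inj j y \<in> R"
      using ij by (simp add: colim_inj_eq PR.coset_eq_iff inj_closed)
    then have "\<Phi> (inj j x \<ominus>\<^bsub>product_space I W\<^esub> inj j y) = \<zero>\<^bsub>W j\<^esub>"
      using \<open>R \<subseteq> Phi.ker\<close> by (auto simp: Phi.ker_def)
    \<comment> \<open>\<open>\<Phi>\<close> undoes \<open>inj j\<close> because
      \<open>trans j j\<close> is the identity.\<close>
    then have "x \<ominus>\<^bsub>W j\<^esub> y = \<zero>\<^bsub>W j\<^esub>"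
      using ij xy by (simp add: inj_closed Phi_inj)
    then show "x = y" using xy by (metis Wj.M.minus_equality Wj.M.minus_minus Wj.M.a_inv_closed a_minus_def)
  qed
  moreover have "colim_inj I W F j ` carrier (W j) = carrier (colim_space I W F)"
  proof
    show "colim_inj I W F j ` carrier (W j) \<subseteq> carrier (colim_space I W F)"
      using linear_map_closed[OF linear_colim_inj] ij by auto
    show "carrier (colim_space I W F) \<subseteq> colim_inj I W F j ` carrier (W j)"
      using coset_in_range_colim_inj[of "{i..j}"]
      by (auto simp: colim_space_eq PR.carrier_quotient_space)
  qed
  ultimately show ?thesis by (simp add: bij_betw_def)
qed

lemma vs_iso_colim_inj: "vs_iso (W j) (colim_space I W F) (colim_inj I W F j)"
  using bij_colim_inj linear_colim_inj ij by (simp add: vs_iso_def)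

text \<open>All components of a compatible family represent one class, so the description in
  \<open>lim_to_colim\<close> has a solution; it is unique because \<open>j\<close> is a
  vertex.\<close>

lemma lim_to_colim_eq:
  assumes "x \<in> carrier (lim_space I W F)"
  shows "lim_to_colim I W F x = colim_inj I W F j (trans i j (lim_proj i x))"
proof -
  have *: "colim_inj I W F j (x j) = colim_inj I W F l (x l)" if l: "l \<in> {i..j}" for l
  proof -
    have "x l \<in> carrier (W l)" using assms l by (auto simp: mem_lim_space PiE_iff)
    then show ?thesis
      using colim_inj_trans[of l j "x l"] lim_space_trans[OF assms, of l j] l by simp
  qed
  have "trans i j (lim_proj i x) = x j"
    using lim_space_trans[OF assms] ij by (simp add: lim_proj_def)
  moreover have "lim_to_colim I W F x = colim_inj I W F j (x j)"
    unfolding lim_to_colim_def lim_proj_def graph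
  proof (rule the_equality)
    show "\<forall>l\<in>{i..j}. colim_inj I W F j (x j) = colim_inj I W F l (x l)"
      using * by blast
    show "y = colim_inj I W F j (x j)" if "\<forall>l\<in>{i..j}. y = colim_inj I W F l (x l)" for y
      using that ij by simp
  qed
  ultimately show ?thesis by simp
qed

lemma persistence_eq:
  "persistence I W F = colim_inj I W F j ` trans i j ` carrier (W i)"
proof -
  have "persistence I W F =
      (\<lambda>w. colim_inj I W F j (trans i j w)) ` lim_proj i ` carrier (lim_space I W F)"
    unfolding persistence_def image_image by (rule image_cong) (auto simp: lim_to_colim_eq)
  also have "lim_proj i ` carrier (lim_space I W F) = carrier (W i)"
    using bij_lim_proj by (simp add: bij_betw_def)
  finally show ?thesis by (simp add: image_image)
qed

end

section \<open>The preradical\<close>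

text \<open>The index sets are the subsets of \<open>{N}\<close>. The empty one contributes the zero
  vector, whence the hypothesis that \<open>N\<close> contains it.\<close>

lemma sum_of_subspaces_singleton:
  fixes V :: "('k::field, 'v) module"
  assumes V: "vectorspace class_ring V" and N: "N \<subseteq> carrier V" "\<zero>\<^bsub>V\<^esub> \<in> N"
  shows "sum_of_subspaces V {N} = N"
proof -
  interpret vectorspace class_ring V by fact
  have sum: "finsum V x {N} = x N" if "x N \<in> N" for x
    using that N by (subst M.finsum_insert) auto
  show ?thesis
  proof
    show "sum_of_subspaces V {N} \<subseteq> N"
      using N(2) sum unfolding sum_of_subspaces_def by (auto simp: subset_singleton_iff)
    show "N \<subseteq> sum_of_subspaces V {N}"
    proof
      fix w assume "w \<in> N"
      then have "w = finsum V (\<lambda>_. w) {N}" using sum[of "\<lambda>_. w"] by simp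
      then show "w \<in> sum_of_subspaces V {N}"
        unfolding sum_of_subspaces_def using \<open>w \<in> N\<close> by blast
    qed
  qed
qed

text \<open>The common core of both parts: once all walks act as \<open>g\<close> on the whole of
  \<open>W a\<close>, the family of images is a singleton, nonempty by \<open>ex\<close>.\<close>

lemma preradical_between_eq_image:
  fixes W :: "'v \<Rightarrow> ('k::field, 'w) module"
  assumes g: "linear_map class_ring (W a) (W b) g"
    and ex: "\<exists>p. pre_digraph.awalk G a p b"
    and path_map_eq: "\<And>p w. pre_digraph.awalk G a p b \<Longrightarrow> w \<in> carrier (W a) \<Longrightarrow> path_map F p w = g w"
  shows "preradical_between G W F a b = g ` carrier (W a)"
proof -
  have "path_map F p ` carrier (W a) = g ` carrier (W a)" if "pre_digraph.awalk G a p b" for p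
    using path_map_eq[OF that] by (rule image_cong[OF refl])
  then have "{f ` carrier (W a) | f. f \<in> path_homs G F a b} = {g ` carrier (W a)}"
    using ex unfolding path_homs_def by blast
  moreover have "g ` carrier (W a) \<subseteq> carrier (W b)"
    using linear_map_closed[OF g] by blast
  moreover have "\<zero>\<^bsub>W a\<^esub> \<in> carrier (W a)"
    using g by (auto simp: linear_map_def vectorspace_def Module.module_def abelian_group_def
        intro: abelian_monoid.zero_closed)
  then have "\<zero>\<^bsub>W b\<^esub> \<in> g ` carrier (W a)"
    using linear_map_zero[OF g] by (metis imageI)
  ultimately show ?thesis
    unfolding preradical_between_def preradical_def
    using sum_of_subspaces_singleton[OF linear_map_vectorspaces(2)[OF g]] by simp
qed

section \<open>Filtrations\<close>

text \<open>A vertex has at most one outgoing arc, so the walk is forced step by step.\<close>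

lemma awalk_filtration_graph_imp:
  assumes "pre_digraph.awalk (filtration_graph n) a p b"
  shows "p = map (\<lambda>l. (l, Suc l)) [a..<b]"
proof -
  \<comment> \<open>The inequality is carried along because \<open>[a..<b]\<close> splits off its
    head only for \<open>a < b\<close>.\<close>
  have "a \<le> b \<and> p = map (\<lambda>l. (l, Suc l)) [a..<b]"
    if "pre_digraph.cas (filtration_graph n) a p b" "set p \<subseteq> arcs (filtration_graph n)" for a
    using that
  proof (induction p arbitrary: a)
    case Nil
    then show ?case by (simp add: pre_digraph.cas.simps)
  next
    case (Cons e p)
    have e: "e = (a, Suc a)" and p: "pre_digraph.cas (filtration_graph n) (Suc a) p b"
      using Cons.prems by (auto simp: pre_digraph.cas.simps filtration_graph_def)
    have "Suc a \<le> b \<and> p = map (\<lambda>l. (l, Suc l)) [Suc a..<b]"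
      using Cons.prems p by (intro Cons.IH) auto
    then show ?case using e by (auto simp: upt_conv_Cons)
  qed
  then show ?thesis using assms by (simp add: pre_digraph.awalk_def)
qed

lemma awalk_filtration_graph:
  assumes "a \<le> b" "b \<le> n"
  shows "pre_digraph.awalk (filtration_graph n) a (map (\<lambda>l. (l, Suc l)) [a..<b]) b"
proof -
  have "pre_digraph.cas (filtration_graph n) a (map (\<lambda>l. (l, Suc l)) [a..<b]) b"
    using assms(1)
  proof (induction a rule: inc_induct)
    case base
    then show ?case by (simp add: pre_digraph.cas.simps)
  next
    case (step a)
    then show ?case
      by (simp add: pre_digraph.cas.simps upt_conv_Cons filtration_graph_def)
  qed
  then show ?thesis
    using assms by (auto simp: pre_digraph.awalk_def filtration_graph_def)
qed

text \<open>An embedding is a homeomorphism onto its image, hence continuous into the whole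
  target.\<close>

lemma linear_pers_map:
  fixes K :: "'k::field itself"
  assumes "graph_filtration X G Xs f" "e \<in> arcs G"
  shows "linear_map class_ring (pers_space K k X Xs (tail G e)) (pers_space K k X Xs (head G e))
    (pers_map K k X G Xs f e)"
proof -
  have "embedding_map (subtopology X (Xs (tail G e))) (subtopology X (Xs (head G e))) (f e)"
    using assms by (simp add: graph_filtration_def)
  then have "continuous_map (subtopology X (Xs (tail G e))) (subtopology X (Xs (head G e))) (f e)"
    using continuous_map_into_fulltopology homeomorphic_imp_continuous_map
    unfolding embedding_map_def by blast
  then show ?thesis
    unfolding pers_space_def pers_map_def by (rule linear_map_homology_map)
qed

text \<open>Limit and colimit are taken over \<open>I\<close>, the preradical over walks in
  \<open>G\<close>. The two agree because the only walk from \<open>i\<close> to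
  \<open>i + p\<close> in \<open>G\<close> passes through exactly the vertices of
  \<open>I\<close>.\<close>

lemma standard_persistence:
  fixes K :: "'k::field itself" and X :: "'a topology" and k n i p :: nat
    and f :: "nat \<times> nat \<Rightarrow> 'a \<Rightarrow> 'a"
  assumes filtr: "graph_filtration X (filtration_graph n) Xs f" and n: "i + p \<le> n"
  defines "G \<equiv> filtration_graph n"
  defines "I \<equiv> G \<restriction> {i..i + p}" and "W \<equiv> pers_space K k X Xs" and "F \<equiv> pers_map K k X G Xs f"
  shows "vs_iso (lim_space I W F) (W i) (lim_proj i)"
    and "vs_iso (W (i + p)) (colim_space I W F) (colim_inj I W F (i + p))"
    and "persistence I W F = colim_inj I W F (i + p) ` preradical_between G W F i (i + p)"
proof -
  have F: "linear_map class_ring (W l) (W (Suc l)) (F (l, Suc l))" if "l < n" for l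
    using linear_pers_map[OF filtr, of "(l, Suc l)" K k] that
    by (simp add: W_def F_def G_def filtration_graph_def)
  interpret linear_chain I W F i "i + p"
  proof (rule linear_chain.intro)
    show "arcs I = {(l, Suc l) | l. i \<le> l \<and> l < i + p}"
      using n by (auto simp: I_def G_def filtration_graph_def)
    show "vectorspace class_ring (W l)" for l
      by (simp add: W_def pers_space_def vectorspace_homology_space)
  qed (use F n in \<open>auto simp: I_def G_def filtration_graph_def\<close>)
  show "vs_iso (lim_space I W F) (W i) (lim_proj i)"
    by (rule vs_iso_lim_proj)
  show "vs_iso (W (i + p)) (colim_space I W F) (colim_inj I W F (i + p))"
    by (rule vs_iso_colim_inj)
  have "preradical_between G W F i (i + p) = trans i (i + p) ` carrier (W i)"
  proof (rule preradical_between_eq_image)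
    show "linear_map class_ring (W i) (W (i + p)) (trans i (i + p))"
      by (rule linear_trans) auto
    show "\<exists>q. pre_digraph.awalk G i q (i + p)"
      using awalk_filtration_graph[of i "i + p" n] n unfolding G_def by auto
    show "path_map F q w = trans i (i + p) w" if "pre_digraph.awalk G i q (i + p)" for q w
      using awalk_filtration_graph_imp that unfolding G_def trans_def by metis
  qed
  then show "persistence I W F = colim_inj I W F (i + p) ` preradical_between G W F i (i + p)"
    using persistence_eq by simp
qed

section \<open>Multifiltrations\<close>

lemma continuous_map_id_subtopology:
  assumes "A \<subseteq> B"
  shows "continuous_map (subtopology X A) (subtopology X B) id"
  using assms by (auto simp: continuous_map_in_subtopology continuous_map_from_subtopology)

text \<open>Induction on the walk, composing the first inclusion with that of the remaining walk.
  Membership of \<open>v\<close> in the grid and \<open>coord_le d u v\<close> are proved along the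
  way because they supply these inclusions.\<close>

lemma grid_walk_homology_map:
  fixes K :: "'k::field itself"
  assumes mf: "multifiltration X d m Xs"
    and u: "u \<in> grid d m" and walk: "set p \<subseteq> arcs (grid_graph d m)"
      "pre_digraph.cas (grid_graph d m) u p v"
  shows "v \<in> grid d m \<and> coord_le d u v \<and>
    (\<forall>A \<in> carrier (pers_space K k X Xs u).
       path_map (pers_map K k X (grid_graph d m) Xs (\<lambda>_. id)) p A =
       homology_map K k (subtopology X (Xs v)) id A)"
  using u walk
proof (induction p arbitrary: u)
  case Nil
  then have "u = v" by (simp add: pre_digraph.cas.simps)
  moreover have "path_map F [] A = homology_map K k (subtopology X (Xs v)) id A"
    if "A \<in> carrier (pers_space K k X Xs v)" for A F
    using homology_map_id[of A K k "subtopology X (Xs v)"] that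
    by (simp only: path_map_def pers_space_def fold_simps)
  ultimately show ?case
    using Nil.prems(1) unfolding coord_le_def by blast
next
  case (Cons e p)
  let ?H = "\<lambda>w. homology_map K k (subtopology X (Xs w)) id"
  obtain i where e: "e = (u, u(i := Suc (u i)))" "i < d" "u i < m"
    and p: "pre_digraph.cas (grid_graph d m) (u(i := Suc (u i))) p v"
    using Cons.prems by (auto simp: pre_digraph.cas.simps grid_graph_def)
  define u' where "u' = u(i := Suc (u i))"
  have u': "u' \<in> grid d m" "coord_le d u u'"
    using Cons.prems e by (auto simp: u'_def grid_def PiE_iff extensional_def coord_le_def)
  have "set p \<subseteq> arcs (grid_graph d m)"
    using Cons.prems(2) by simp
  note IH_conj = Cons.IH[OF u'(1) this p[folded u'_def]]
  have IH: "v \<in> grid d m" "coord_le d u' v"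
    "\<And>A. A \<in> carrier (pers_space K k X Xs u') \<Longrightarrow>
       path_map (pers_map K k X (grid_graph d m) Xs (\<lambda>_. id)) p A = ?H v A"
    using IH_conj by blast+
  have "coord_le d u v"
    using u'(2) IH(2) by (force simp: coord_le_def intro: order_trans)
  have cont: "continuous_map (subtopology X (Xs a)) (subtopology X (Xs b)) id"
    if "a \<in> grid d m" "b \<in> grid d m" "coord_le d a b" for a b
    using mf that by (intro continuous_map_id_subtopology) (auto simp: multifiltration_def)
  have "path_map (pers_map K k X (grid_graph d m) Xs (\<lambda>_. id)) (e # p) A = ?H v A"
    if A: "A \<in> carrier (pers_space K k X Xs u)" for A
  proof -
    have u'A: "?H u' A \<in> carrier (pers_space K k X Xs u')"
      using linear_map_closed[OF linear_map_homology_map[OF cont[OF Cons.prems(1) u']]] A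
      by (simp add: pers_space_def)
    have "path_map (pers_map K k X (grid_graph d m) Xs (\<lambda>_. id)) (e # p) A =
        path_map (pers_map K k X (grid_graph d m) Xs (\<lambda>_. id)) p (?H u' A)"
      using e by (simp add: path_map_def pers_map_def u'_def grid_graph_def)
    also have "\<dots> = ?H v (?H u' A)"
      by (rule IH(3)[OF u'A])
    also have "\<dots> = ?H v A"
      using A by (intro homology_map_id_comp[OF _ cont cont])
        (use Cons.prems u' IH in \<open>auto simp: pers_space_def\<close>)
    finally show ?thesis .
  qed
  then show ?case
    using IH(1) \<open>coord_le d u v\<close> by blast
qed

text \<open>While \<open>w\<close> differs from \<open>v\<close>, some coordinate lies strictly
  below that of \<open>v\<close>, and raising it by 1 stays between \<open>u\<close> and
  \<open>v\<close>. The walk thus remains in the subgraph and serves both forms of the rank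
  formula.\<close>

lemma ex_grid_walk:
  assumes w: "w \<in> grid d m" "coord_le d u w" "coord_le d w v" and v: "v \<in> grid d m"
  shows "\<exists>p. pre_digraph.cas (grid_graph d m) w p v \<and>
    set p \<subseteq> arcs (grid_graph d m \<restriction> {w \<in> verts (grid_graph d m). coord_le d u w \<and> coord_le d w v})"
  using w
proof (induction "\<Sum>i<d. v i - w i" arbitrary: w rule: less_induct)
  case less
  show ?case
  proof (cases "w = v")
    case True
    then show ?thesis by (intro exI[of _ "[]"]) (simp add: pre_digraph.cas.simps)
  next
    case False
    then obtain i where "w i \<noteq> v i" by blast
    \<comment> \<open>Grid points are \<open>undefined\<close> outside \<open>{..<d}\<close>, so
      they can differ only at a genuine coordinate.\<close>
    moreover from this have i: "i < d"
      using less.prems v by (force simp: grid_def PiE_iff extensional_def)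
    ultimately have wi: "w i < v i"
      using less.prems by (auto simp: coord_le_def nat_less_le)
    moreover have "v i \<le> m" using v i by (auto simp: grid_def PiE_iff)
    ultimately have wm: "w i < m" by simp
    define w' where "w' = w(i := Suc (w i))"
    have w': "w' \<in> grid d m" "coord_le d u w'" "coord_le d w' v"
      using less.prems wi wm i
      by (auto simp: w'_def grid_def PiE_iff extensional_def coord_le_def le_SucI)
    \<comment> \<open>Truncated subtraction strictly decreases at \<open>i\<close> because
      \<open>w i < v i\<close>; the other terms are unchanged.\<close>
    have "(\<Sum>i<d. v i - w' i) < (\<Sum>i<d. v i - w i)"
      by (rule sum_strict_mono_ex1) (use i wi in \<open>auto simp: w'_def\<close>)
    then obtain p where p: "pre_digraph.cas (grid_graph d m) w' p v"
      "set p \<subseteq> arcs (grid_graph d m \<restriction> {w \<in> verts (grid_graph d m). coord_le d u w \<and> coord_le d w v})"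
      using less.hyps w' by blast
    have "(w, w') \<in> arcs (grid_graph d m)"
      using less.prems i wm by (auto simp: grid_graph_def w'_def)
    then have "(w, w') \<in> arcs (grid_graph d m \<restriction> {w \<in> verts (grid_graph d m). coord_le d u w \<and> coord_le d w v})"
      using less.prems w' by (simp add: grid_graph_def)
    moreover have "tail (grid_graph d m) (w, w') = w" "head (grid_graph d m) (w, w') = w'"
      by (simp_all add: grid_graph_def)
    ultimately show ?thesis
      using p by (intro exI[of _ "(w, w') # p"]) (simp add: pre_digraph.cas.simps)
  qed
qed

text \<open>\<open>cas\<close> inspects only tails and heads, which an induced subgraph inherits;
  the set of arcs enters separately in \<open>awalk\<close>.\<close>

lemma cas_induce_subgraph: "pre_digraph.cas (G \<restriction> S) u p v = pre_digraph.cas G u p v"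
  by (induction p arbitrary: u) (auto simp: pre_digraph.cas.simps)

text \<open>The rank is by definition the dimension of the image of \<open>?h\<close>, and both
  preradicals equal that image: the walk built inside \<open>H\<close> exists in both graphs, and
  arcs of \<open>H\<close> are arcs of \<open>G\<close>.\<close>

lemma multidimensional_persistence:
  fixes K :: "'k::field itself" and X :: "'a topology" and k d m :: nat
  assumes mf: "multifiltration X d m Xs"
    and uv: "u \<in> grid d m" "v \<in> grid d m" "coord_le d u v"
  defines "G \<equiv> grid_graph d m"
  defines "H \<equiv> G \<restriction> {w \<in> verts G. coord_le d u w \<and> coord_le d w v}"
    and "W \<equiv> pers_space K k X Xs" and "F \<equiv> pers_map K k X G Xs (\<lambda>_. id)"
  shows "rank_invariant K k X Xs u v = vs_dim (W v) (preradical_between G W F u v)"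
    and "rank_invariant K k X Xs u v = vs_dim (W v) (preradical_between H W F u v)"
proof -
  let ?h = "homology_map K k (subtopology X (Xs v)) id"
  have "Xs u \<subseteq> Xs v" using mf uv by (simp add: multifiltration_def)
  then have "continuous_map (subtopology X (Xs u)) (subtopology X (Xs v)) id"
    by (rule continuous_map_id_subtopology)
  then have h: "linear_map class_ring (W u) (W v) ?h"
    unfolding W_def pers_space_def by (rule linear_map_homology_map)
  obtain p where p: "pre_digraph.cas G u p v" "set p \<subseteq> arcs H"
    using ex_grid_walk[OF uv(1) _ uv(3,2), of u] by (auto simp: G_def H_def coord_le_def)
  have eq: "path_map F q A = ?h A" if "set q \<subseteq> arcs G" "pre_digraph.cas G u q v" "A \<in> carrier (W u)" for q A
    using grid_walk_homology_map[OF mf uv(1)] that unfolding G_def F_def W_def by blast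
  have H: "arcs H \<subseteq> arcs G" by (auto simp: H_def)
  have verts: "u \<in> verts G" "u \<in> verts H"
    using uv by (auto simp: G_def H_def grid_graph_def coord_le_def)
  have "preradical_between G W F u v = ?h ` carrier (W u)"
    by (rule preradical_between_eq_image[where W = W and a = u and b = v, OF h])
      (use p H verts eq in \<open>auto simp: pre_digraph.awalk_def\<close>)
  moreover have "preradical_between H W F u v = ?h ` carrier (W u)"
    by (rule preradical_between_eq_image[where W = W and a = u and b = v, OF h])
      (use p H verts eq in \<open>auto simp: pre_digraph.awalk_def H_def cas_induce_subgraph\<close>)
  ultimately show "rank_invariant K k X Xs u v = vs_dim (W v) (preradical_between G W F u v)"
    and "rank_invariant K k X Xs u v = vs_dim (W v) (preradical_between H W F u v)"
    by (simp_all add: rank_invariant_def W_def pers_space_def)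
qed

theorem proposition4p2:
  fixes K :: "'k::field itself" and X :: "'a topology" and k :: nat
  shows
    "(\<forall>n i p Xs f.
        graph_filtration X (filtration_graph n) Xs f \<and>
        commutative_diagram (filtration_graph n) Xs f \<and> i + p \<le> n \<longrightarrow>
        (let G = filtration_graph n; I = G \<restriction> {i..i + p};
             W = pers_space K k X Xs; F = pers_map K k X G Xs f
         in vs_iso (lim_space I W F) (W i) (lim_proj i) \<and>
            vs_iso (W (i + p)) (colim_space I W F) (colim_inj I W F (i + p)) \<and>
            persistence I W F = colim_inj I W F (i + p) ` preradical_between G W F i (i + p))) \<and>
     (\<forall>d m Xs u v.
        multifiltration X d m Xs \<and> u \<in> grid d m \<and> v \<in> grid d m \<and> coord_le d u v \<longrightarrow>
        (let G = grid_graph d m; G_uv = G \<restriction> {w \<in> verts G. coord_le d u w \<and> coord_le d w v};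
             W = pers_space K k X Xs; F = pers_map K k X G Xs (\<lambda>_. id)
         in rank_invariant K k X Xs u v = vs_dim (W v) (preradical_between G W F u v) \<and>
            rank_invariant K k X Xs u v = vs_dim (W v) (preradical_between G_uv W F u v)))"
  unfolding Let_def
  by (intro conjI allI impI; (elim conjE)?)
    (rule standard_persistence multidimensional_persistence; assumption)+

end
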